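(* Let $\Phi^{XYA}\in\mathcal C_\star^{XYA}$ and $\Psi^{XYB}\in\mathcal C_\star^{XYB}$, and define $$f(\Phi,\Psi)=\min_{\Lambda^{XYB}\in\mathcal C_\star^{XYB}}\ \max_{\Theta}\ \big\langle(\mathbb 1^{XY}\otimes\Theta)[\Phi^{XYA}]-\Psi^{XYB},\,\Lambda^{XYB}\big\rangle,$$ where the maximum is over all superchannels $\Theta:\mathcal L^A\to\mathcal L^B$. Then there exists a superchannel $\Theta:\mathcal L^A\to\mathcal L^B$ with $\Psi^{XYB}=(\mathbb 1^{XY}\otimes\Theta)[\Phi^{XYA}]$ if and only if $f(\Phi,\Psi)\ge0$. Moreover $f(\Phi,\Psi)$ is the optimal value of the semidefinite program $$f(\Phi,\Psi)=\min\Big\{\mathrm{Tr}[\gamma^{AB_0}]-\mathrm{Tr}\big[J_\Psi^{XYB}J_\Lambda^{XYB}\big]\Big\}$$ over Hermitian $\gamma^{AB_0}$ and $J_\Lambda^{XYB}=\frac1{d_X}\sum_{x,y}|xy\rangle\langle xy|^{XY}\otimes J^B_{\Lambda_{y|x}}$, subject to 1. $\gamma^{AB_0}\otimes I^{B_1}\ \ge\ \frac1{d_{A_0}d_X^2}\sum_{x=1}^{d_X}\sum_{y=1}^{d_Y}\big(J^A_{\Phi_{y|x}}\big)^T\otimes J^B_{\Lambda_{y|x}}$; 2. $\gamma^{A_0B_0}=u^{A_0}\otimes\gamma^{B_0}$; 3. $J_\Lambda^{XB_0}=u^X\otimes I^{B_0}$ and $J_\Lambda^{XYB}\ge0$.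
   Context: All Hilbert spaces are finite-dimensional; $d_S=\dim\mathcal H^S$. Each party $A$ has an input system $A_0$ and an output system $A_1$, and $A$ as a label of operators means $A_0A_1$. $\mathcal L^A$ is the space of linear maps $\mathcal B(\mathcal H^{A_0})\to\mathcal B(\mathcal H^{A_1})$. $\mathbb 1^C$ is the identity map on $\mathcal L^C$. Superchannel: a linear map $\Theta:\mathcal L^A\to\mathcal L^B$ such that (i) for every party $C=(C_0,C_1)$, $\mathbb 1^C\otimes\Theta$ sends completely positive maps to completely positive maps, and (ii) $\Theta$ sends trace-preserving maps to trace-preserving maps. Choi matrix of $\Psi\in\mathcal L^A$: $J_\Psi^A=\sum_{i,j}|i\rangle\langle j|^{A_0}\otimes\Psi(|i\rangle\langle j|)$. Inner product on $\mathcal L^A$: $\langle\Phi,\Psi\rangle=\mathrm{Tr}[(J_\Phi)^*J_\Psi]$, where $*$ is the adjoint. $T$ denotes transpose in the fixed basis. Deleting system labels from an operator denotes partial trace; $u^S=I^S/d_S$. $X$ and $Y$ are classical parties with one-dimensional inputs and outputs of dimensions $d_X,d_Y$ with fixed orthonormal bases. $\mathcal C_\star^{XYA}$ is the set of channels of the form $\Phi^{XYA}=\frac1{d_X}\sum_{x=1}^{d_X}\sum_{y=1}^{d_Y}|xy\rangle\langle xy|^{XY}\otimes\Phi^A_{y|x}$, i.e. $\rho\mapsto\frac1{d_X}\sum_{x,y}|xy\rangle\langle xy|\otimes\Phi^A_{y|x}(\rho)$, where each $\Phi^A_{y|x}$ is a completely positive map from $A_0$ to $A_1$ and $\sum_y\Phi^A_{y|x}$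 is completely positive and trace preserving for every $x$. $\mathcal C_\star^{XYB}$ is defined likewise. $\mathbb 1^{XY}\otimes\Theta$ acts as $\frac1{d_X}\sum_{x,y}|xy\rangle\langle xy|\otimes\Phi_{y|x}^A\mapsto\frac1{d_X}\sum_{x,y}|xy\rangle\langle xy|\otimes\Theta[\Phi_{y|x}^A]$. *)

theory Defs
  imports "HOL-Analysis.Analysis"
begin

text \<open>
  A system with Hilbert space of dimension $d$ is given by a finite index type \<open>'n\<close> with
  \<open>CARD('n) = d\<close> labelling its fixed orthonormal basis.  Tensor products of systems are
  product types.
\<close>

type_synonym 'n op = "complex^'n^'n"
type_synonym ('m, 'n) map = "'m op \<Rightarrow> 'n op"

subsection \<open>Operators\<close>

definition cscale :: "complex \<Rightarrow> 'n::finite op \<Rightarrow> 'n op" where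
  "cscale c M = map_matrix ((*) c) M"

definition adj :: "'n::finite op \<Rightarrow> 'n op" where
  "adj M = transpose (map_matrix cnj M)"

definition hermitian :: "'n::finite op \<Rightarrow> bool" where
  "hermitian M \<longleftrightarrow> adj M = M"

definition psd :: "'n::finite op \<Rightarrow> bool" where
  "psd M \<longleftrightarrow> (\<forall>v::complex^'n. (\<Sum>i\<in>UNIV. \<Sum>j\<in>UNIV. cnj (v $ i) * M $ i $ j * v $ j) \<in> \<real>\<^sub>\<ge>\<^sub>0)"

definition loewner_le :: "'n::finite op \<Rightarrow> 'n op \<Rightarrow> bool" (infix "\<preceq>" 50) where
  "M \<preceq> N \<longleftrightarrow> psd (N - M)"

definition mat_unit :: "'n::finite \<Rightarrow> 'n \<Rightarrow> 'n op" where
  "mat_unit i j = (\<chi> k l. if k = i \<and> l = j then 1 else 0)"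

definition tensor :: "'m::finite op \<Rightarrow> 'n::finite op \<Rightarrow> ('m \<times> 'n) op" (infixr "\<otimes>" 75) where
  "M \<otimes> N = (\<chi> p q. M $ fst p $ fst q * N $ snd p $ snd q)"

definition uniform :: "'n::finite op" where
  "uniform = mat (1 / of_nat CARD('n))"

text \<open>Relabelling of basis vectors; only used to rearrange the order of tensor factors.\<close>

definition reindex :: "('m::finite \<Rightarrow> 'n::finite) \<Rightarrow> 'n op \<Rightarrow> 'm op" where
  "reindex g M = (\<chi> i j. M $ g i $ g j)"

text \<open>Partial trace: \<open>g i k\<close> is the basis label composed of the label \<open>i\<close> of the
  systems that are kept and the label \<open>k\<close> of the systems that are traced out.\<close>

definition ptrace :: "('m::finite \<Rightarrow> 'k::finite \<Rightarrow> 'n::finite) \<Rightarrow> 'n op \<Rightarrow> 'm op" where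
  "ptrace g M = (\<chi> i j. \<Sum>k\<in>UNIV. M $ g i k $ g j k)"

subsection \<open>Linear maps between operator spaces\<close>

text \<open>\<open>lin_maps\<close> is the space $\mathcal L^A$; note that \<open>linear\<close> without qualification would only
  mean linearity over the reals.\<close>

definition lin_maps :: "('m::finite, 'n::finite) map set" where
  "lin_maps = {\<Phi>. Vector_Spaces.linear cscale cscale \<Phi>}"

definition trace_preserving :: "('m::finite, 'n::finite) map \<Rightarrow> bool" where
  "trace_preserving \<Phi> \<longleftrightarrow> (\<forall>\<rho>. trace (\<Phi> \<rho>) = trace \<rho>)"

text \<open>
  Auxiliary systems of arbitrary dimension are quantified over inside the definitions, so they
  cannot be types.  An operator on $\mathbb C^K \otimes \mathcal H$, for a finite set $K$ of
  basis labels, is instead the family of its blocks $\rho_{kl} \in \mathcal B(\mathcal H)$,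
  $k, l \in K$; entries outside $K$ are irrelevant.
\<close>

definition block_psd :: "'k set \<Rightarrow> ('k \<Rightarrow> 'k \<Rightarrow> 'n::finite op) \<Rightarrow> bool" where
  "block_psd K \<rho> \<longleftrightarrow> (\<forall>v :: 'k \<Rightarrow> complex^'n.
     (\<Sum>k\<in>K. \<Sum>l\<in>K. \<Sum>i\<in>UNIV. \<Sum>j\<in>UNIV. cnj (v k $ i) * \<rho> k l $ i $ j * v l $ j) \<in> \<real>\<^sub>\<ge>\<^sub>0)"

text \<open>\<open>\<Phi>\<close> is completely positive: $\mathbb 1_R \otimes \Phi$ is positive for $R = \mathbb C^r$ and all $r$.\<close>

definition cp_map :: "('m::finite, 'n::finite) map \<Rightarrow> bool" where
  "cp_map \<Phi> \<longleftrightarrow> \<Phi> \<in> lin_maps \<and>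
     (\<forall>r::nat. \<forall>\<rho>. block_psd {..<r} \<rho> \<longrightarrow> block_psd {..<r} (\<lambda>s t. \<Phi> (\<rho> s t)))"

text \<open>
  For a party $C$ with input dimension \<open>c0\<close> and output dimension \<open>c1\<close>, an element of
  $\mathcal L^{CA} = \mathcal L^C \otimes \mathcal L^A$ is given by its coefficients
  \<open>N p q k l\<close> $\in \mathcal L^A$ (\<open>p, q < c1\<close> and \<open>k, l < c0\<close>) with respect to the basis
  $|k'\rangle\langle l'| \mapsto \delta_{kk'}\delta_{ll'} |p\rangle\langle q|$ of $\mathcal L^C$.
  Accordingly \<open>apply_coeffs\<close> is the map it describes on block operators, and
  $\mathbb 1^C \otimes \Theta$ acts by applying $\Theta$ to each coefficient.
\<close>

type_synonym ('m, 'n) coeffs = "nat \<Rightarrow> nat \<Rightarrow> nat \<Rightarrow> nat \<Rightarrow> ('m, 'n) map"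

definition apply_coeffs ::
    "nat \<Rightarrow> ('m::finite, 'n::finite) coeffs \<Rightarrow> (nat \<Rightarrow> nat \<Rightarrow> 'm op) \<Rightarrow> (nat \<Rightarrow> nat \<Rightarrow> 'n op)" where
  "apply_coeffs c0 N \<rho> = (\<lambda>p q. \<Sum>k<c0. \<Sum>l<c0. N p q k l (\<rho> k l))"

text \<open>Operators on $R \otimes C_0 \otimes A_0$ are blocks indexed by pairs; $\mathbb 1_R \otimes N$
  applies \<open>N\<close> to the $(s,t)$ block with respect to $R$.\<close>

definition cp_coeffs :: "nat \<Rightarrow> nat \<Rightarrow> ('m::finite, 'n::finite) coeffs \<Rightarrow> bool" where
  "cp_coeffs c0 c1 N \<longleftrightarrow> (\<forall>p q k l. N p q k l \<in> lin_maps) \<and>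
     (\<forall>r::nat. \<forall>\<rho> :: nat \<times> nat \<Rightarrow> nat \<times> nat \<Rightarrow> 'm op.
        block_psd ({..<r} \<times> {..<c0}) \<rho> \<longrightarrow>
        block_psd ({..<r} \<times> {..<c1})
          (\<lambda>(s, p) (t, q). apply_coeffs c0 N (\<lambda>k l. \<rho> (s, k) (t, l)) p q))"

subsection \<open>Superchannels\<close>

text \<open>Only the values of \<open>\<Theta>\<close> on \<open>lin_maps\<close> are meaningful.\<close>

definition linear_supermap ::
    "(('a0::finite, 'a1::finite) map \<Rightarrow> ('b0::finite, 'b1::finite) map) \<Rightarrow> bool" where
  "linear_supermap \<Theta> \<longleftrightarrow>
     (\<forall>\<Phi>\<in>lin_maps. \<Theta> \<Phi> \<in> lin_maps) \<and>
     (\<forall>\<Phi>\<in>lin_maps. \<forall>\<Psi>\<in>lin_maps. \<Theta> (\<lambda>\<rho>. \<Phi> \<rho> + \<Psi> \<rho>) = (\<lambda>\<rho>. \<Theta> \<Phi> \<rho> + \<Theta> \<Psi> \<rho>)) \<and>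
     (\<forall>c. \<forall>\<Phi>\<in>lin_maps. \<Theta> (\<lambda>\<rho>. cscale c (\<Phi> \<rho>)) = (\<lambda>\<rho>. cscale c (\<Theta> \<Phi> \<rho>)))"

definition superchannel ::
    "(('a0::finite, 'a1::finite) map \<Rightarrow> ('b0::finite, 'b1::finite) map) \<Rightarrow> bool" where
  "superchannel \<Theta> \<longleftrightarrow> linear_supermap \<Theta> \<and>
     (\<forall>c0 c1 N. cp_coeffs c0 c1 N \<longrightarrow> cp_coeffs c0 c1 (\<lambda>p q k l. \<Theta> (N p q k l))) \<and>
     (\<forall>\<Phi>\<in>lin_maps. trace_preserving \<Phi> \<longrightarrow> trace_preserving (\<Theta> \<Phi>))"

subsection \<open>Choi matrices and the inner product\<close>

definition choi :: "('m::finite, 'n::finite) map \<Rightarrow> ('m \<times> 'n) op" where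
  "choi \<Phi> = (\<Sum>i\<in>UNIV. \<Sum>j\<in>UNIV. mat_unit i j \<otimes> \<Phi> (mat_unit i j))"

definition map_inner :: "('m::finite, 'n::finite) map \<Rightarrow> ('m, 'n) map \<Rightarrow> complex" where
  "map_inner \<Phi> \<Psi> = trace (adj (choi \<Phi>) ** choi \<Psi>)"

subsection \<open>Channels with classical parties X and Y\<close>

text \<open>$\frac1{d_X}\sum_{x,y} |xy\rangle\langle xy| \otimes M_{y|x}$\<close>

definition cq_op :: "('x::finite \<Rightarrow> 'y::finite \<Rightarrow> 'n::finite op) \<Rightarrow> ('x \<times> 'y \<times> 'n) op" where
  "cq_op M = (1 / real CARD('x)) *\<^sub>R
     (\<Sum>x\<in>UNIV. \<Sum>y\<in>UNIV. mat_unit x x \<otimes> mat_unit y y \<otimes> M x y)"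

text \<open>In a family of maps, \<open>\<Phi> x y\<close> stands for $\Phi_{y|x}$.  The one-dimensional input systems
  of $X$ and $Y$ are omitted.\<close>

definition cq_map ::
    "('x::finite \<Rightarrow> 'y::finite \<Rightarrow> ('m::finite, 'n::finite) map) \<Rightarrow> ('m, 'x \<times> 'y \<times> 'n) map" where
  "cq_map \<Phi> = (\<lambda>\<rho>. cq_op (\<lambda>x y. \<Phi> x y \<rho>))"

definition conditional_family ::
    "('x::finite \<Rightarrow> 'y::finite \<Rightarrow> ('m::finite, 'n::finite) map) \<Rightarrow> bool" where
  "conditional_family \<Phi> \<longleftrightarrow> (\<forall>x y. cp_map (\<Phi> x y)) \<and>
     (\<forall>x. cp_map (\<lambda>\<rho>. \<Sum>y\<in>UNIV. \<Phi> x y \<rho>) \<and> trace_preserving (\<lambda>\<rho>. \<Sum>y\<in>UNIV. \<Phi> x y \<rho>))"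

definition C_star :: "('m::finite, 'x::finite \<times> 'y::finite \<times> 'n::finite) map set" where
  "C_star = {cq_map \<Phi> |\<Phi>. conditional_family \<Phi>}"

text \<open>$\mathbb 1^{XY} \otimes \Theta$ applies $\Theta$ to every block of a map with respect to the
  matrix units of $XY$; its action on maps of the form \<open>cq_map \<Phi>\<close> is given by
  \<open>id_XY_cq_map\<close> below.\<close>

definition block_XY ::
    "('m::finite, 'x::finite \<times> 'y::finite \<times> 'n::finite) map \<Rightarrow> 'x \<times> 'y \<Rightarrow> 'x \<times> 'y \<Rightarrow> ('m, 'n) map" where
  "block_XY N p q = (\<lambda>\<rho>. \<chi> i j. N \<rho> $ (fst p, snd p, i) $ (fst q, snd q, j))"

definition id_XY ::
    "(('a0::finite, 'a1::finite) map \<Rightarrow> ('b0::finite, 'b1::finite) map) \<Rightarrow>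
     ('a0, 'x::finite \<times> 'y::finite \<times> 'a1) map \<Rightarrow> ('b0, 'x \<times> 'y \<times> 'b1) map" where
  "id_XY \<Theta> N = (\<lambda>\<rho>. \<chi> p q. case (p, q) of ((x, y, i), (x', y', j)) \<Rightarrow>
     \<Theta> (block_XY N (x, y) (x', y')) \<rho> $ i $ j)"

lemma cq_op_nth:
  "cq_op M $ (x, y, i) $ (x', y', j) =
     (if x = x' \<and> y = y' then of_real (1 / real CARD('x)) * M x y $ i $ j else 0)"
  for M :: "'x::finite \<Rightarrow> 'y::finite \<Rightarrow> 'n::finite op"
proof -
  have "(\<Sum>a\<in>UNIV. \<Sum>b\<in>UNIV. (mat_unit a a \<otimes> mat_unit b b \<otimes> M a b)) $ (x, y, i) $ (x', y', j) =
      (\<Sum>a\<in>UNIV. \<Sum>b\<in>UNIV. if x = a then (if y = b then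
          (if x = x' \<and> y = y' then M x y $ i $ j else 0) else 0) else 0)"
    unfolding sum_component
    by (intro sum.cong refl) (auto simp: tensor_def mat_unit_def)
  also have "\<dots> = (if x = x' \<and> y = y' then M x y $ i $ j else 0)"
  proof -
    have "(\<Sum>b\<in>(UNIV::'y set). if x = a then (if y = b then c else 0) else 0) =
        (if x = a then c else (0::complex))" for a :: 'x and c
      by simp
    then show ?thesis by simp
  qed
  finally show ?thesis
    unfolding cq_op_def vector_scaleR_component
    by (simp add: scaleR_conv_of_real[where 'a = complex])
qed

lemma id_XY_cq_map:
  fixes \<Phi> :: "'x::finite \<Rightarrow> 'y::finite \<Rightarrow> ('a0::finite, 'a1::finite) map"
    and \<Theta> :: "('a0, 'a1) map \<Rightarrow> ('b0::finite, 'b1::finite) map"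
  assumes \<Theta>: "linear_supermap \<Theta>" and \<Phi>: "\<And>x y. \<Phi> x y \<in> lin_maps"
  shows "id_XY \<Theta> (cq_map \<Phi>) = cq_map (\<lambda>x y. \<Theta> (\<Phi> x y))"
proof -
  let ?c = "complex_of_real (1 / real CARD('x))"
  have scale: "\<Theta> (\<lambda>\<rho>. cscale c (\<Phi> x y \<rho>)) = (\<lambda>\<rho>. cscale c (\<Theta> (\<Phi> x y) \<rho>))" for c x y
    using \<Theta> \<Phi> unfolding linear_supermap_def by blast
  have block: "block_XY (cq_map \<Phi>) (x, y) (x', y') =
      (\<lambda>\<rho>. cscale (if x = x' \<and> y = y' then ?c else 0) (\<Phi> x y \<rho>))" for x y x' y'
    by (auto simp: block_XY_def cq_map_def cq_op_nth cscale_def map_matrix_def vec_eq_iff fun_eq_iff)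
  show ?thesis
    unfolding id_XY_def block scale
    by (auto simp: fun_eq_iff vec_eq_iff cq_map_def cq_op_nth cscale_def)
qed

subsection \<open>The min-max quantity\<close>

text \<open>The inner products below are between maps with Hermitian Choi matrices, hence real; \<open>Re\<close>
  only adjusts the type.\<close>

definition payoff ::
    "('a0::finite, 'x::finite \<times> 'y::finite \<times> 'a1::finite) map \<Rightarrow>
     ('b0::finite, 'x \<times> 'y \<times> 'b1::finite) map \<Rightarrow> ('b0, 'x \<times> 'y \<times> 'b1) map \<Rightarrow>
     (('a0, 'a1) map \<Rightarrow> ('b0, 'b1) map) \<Rightarrow> real" where
  "payoff \<Phi> \<Psi> \<Lambda> \<Theta> = Re (map_inner (\<lambda>\<rho>. id_XY \<Theta> \<Phi> \<rho> - \<Psi> \<rho>) \<Lambda>)"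

definition max_payoff ::
    "('a0::finite, 'x::finite \<times> 'y::finite \<times> 'a1::finite) map \<Rightarrow>
     ('b0::finite, 'x \<times> 'y \<times> 'b1::finite) map \<Rightarrow> ('b0, 'x \<times> 'y \<times> 'b1) map \<Rightarrow> real" where
  "max_payoff \<Phi> \<Psi> \<Lambda> = (GREATEST r. \<exists>\<Theta>. superchannel \<Theta> \<and> r = payoff \<Phi> \<Psi> \<Lambda> \<Theta>)"

definition minmax ::
    "('a0::finite, 'x::finite \<times> 'y::finite \<times> 'a1::finite) map \<Rightarrow>
     ('b0::finite, 'x \<times> 'y \<times> 'b1::finite) map \<Rightarrow> real" where
  "minmax \<Phi> \<Psi> = (LEAST r. \<exists>\<Lambda>\<in>C_star. r = max_payoff \<Phi> \<Psi> \<Lambda>)"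

subsection \<open>The semidefinite program\<close>

text \<open>\<open>cq_choi \<Lambda>\<close> is $J_\Lambda^{XYB}$, with tensor factors in the order $X, Y, B_0, B_1$.\<close>

definition cq_choi ::
    "('x::finite \<Rightarrow> 'y::finite \<Rightarrow> ('m::finite, 'n::finite) map) \<Rightarrow> ('x \<times> 'y \<times> ('m \<times> 'n)) op" where
  "cq_choi \<Lambda> = cq_op (\<lambda>x y. choi (\<Lambda> x y))"

definition sdp_feasible ::
    "('x::finite \<Rightarrow> 'y::finite \<Rightarrow> ('a0::finite, 'a1::finite) map) \<Rightarrow>
     (('a0 \<times> 'a1) \<times> 'b0::finite) op \<Rightarrow> ('x \<Rightarrow> 'y \<Rightarrow> ('b0, 'b1::finite) map) \<Rightarrow> bool" where
  "sdp_feasible \<Phi> \<gamma> \<Lambda> \<longleftrightarrow>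
     hermitian \<gamma> \<and> (\<forall>x y. \<Lambda> x y \<in> lin_maps) \<and>
     (1 / (real CARD('a0) * (real CARD('x))\<^sup>2)) *\<^sub>R
         (\<Sum>x\<in>UNIV. \<Sum>y\<in>UNIV. transpose (choi (\<Phi> x y)) \<otimes> choi (\<Lambda> x y))
       \<preceq> reindex (\<lambda>(a, b0, b1). ((a, b0), b1)) (\<gamma> \<otimes> (mat 1 :: 'b1 op)) \<and>
     ptrace (\<lambda>(a0, b0) a1. ((a0, a1), b0)) \<gamma> =
       (uniform :: 'a0 op) \<otimes> ptrace (\<lambda>b0 a. (a, b0)) \<gamma> \<and>
     ptrace (\<lambda>(x, b0) (y, b1). (x, y, b0, b1)) (cq_choi \<Lambda>) =
       (uniform :: 'x op) \<otimes> (mat 1 :: 'b0 op) \<and>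
     psd (cq_choi \<Lambda>)"

definition sdp_values ::
    "('x::finite \<Rightarrow> 'y::finite \<Rightarrow> ('a0::finite, 'a1::finite) map) \<Rightarrow>
     ('x \<Rightarrow> 'y \<Rightarrow> ('b0::finite, 'b1::finite) map) \<Rightarrow> real set" where
  "sdp_values \<Phi> \<Psi> = {Re (trace \<gamma> - trace (cq_choi \<Psi> ** cq_choi \<Lambda>)) |\<gamma> \<Lambda>. sdp_feasible \<Phi> \<gamma> \<Lambda>}"

end

(*
A superchannel Theta is determined by its Choi matrix J, and the superchannels correspond to the
positive semidefinite J with <J, gamma (x) I> = Tr(gamma) / d_A0 for all gamma on A B_0 that satisfy
condition 2 of the program: complete positivity is positivity of J (Choi's theorem in one
direction, the Schur product theorem in the other), and the linear equations express preservation
of trace preservation.  In these terms the payoff is bilinear on the product of two compact convex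
sets, so the maximum and the minimum are attained.  For fixed Lambda the maximum over J is a conic
program whose dual is the minimum over gamma; the identity is strictly feasible, so there is no
duality gap and the dual optimum is attained.  Finally, if the differences Theta[Phi] - Psi omit 0,
let s be the one of smallest norm; since s has vanishing marginals, the uniform family minus a small
multiple of s lies in C_star and has negative payoff for every Theta, so minmax < 0.
*)

theory Submission
  imports Defs
begin

section \<open>Positive kernels on finite sets\<close>

text \<open>The order of minimum and maximum is never exchanged, so no minimax theorem occurs:
  duality rewrites only the inner maximum, and the resulting minimum over \<gamma> joins the outer
  one. Complete positivity quantifies over auxiliary systems of every dimension, which no fixed
  matrix type covers; positivity is therefore developed for kernels on arbitrary finite sets, with
  matrices and block operators as instances, and a Gram factorisation of such kernels does the work
  of the spectral theorem. Separation, closest points and compactness come from the real inner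
  product Re Tr(X* Y) on complex matrices; it sees only real parts, so hermiticity has to be imposed
  or recovered separately. The factor 1/d_A0 has this origin: if X is the hermitian Choi matrix of a
  trace preserving map and \<gamma> is the tensor product of its transpose with Z, then Tr \<gamma>
  = d_A0 Tr Z, while \<open>J\<close> pairs with \<gamma> (x) I to Re Tr Z, because the image of X
  again has the identity as its marginal.\<close>

definition pos_kernel :: "'i set \<Rightarrow> ('i \<Rightarrow> 'i \<Rightarrow> complex) \<Rightarrow> bool" where
  "pos_kernel S K \<longleftrightarrow> (\<forall>v. (\<Sum>i\<in>S. \<Sum>j\<in>S. cnj (v i) * K i j * v j) \<in> \<real>\<^sub>\<ge>\<^sub>0)"

lemma nonneg_Reals_iff: "z \<in> \<real>\<^sub>\<ge>\<^sub>0 \<longleftrightarrow> 0 \<le> Re z \<and> Im z = 0"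
  by (simp add: complex_nonneg_Reals_iff)

lemma pos_kernel_cong:
  assumes "\<And>i j. i \<in> S \<Longrightarrow> j \<in> S \<Longrightarrow> K i j = L i j"
  shows "pos_kernel S K \<longleftrightarrow> pos_kernel S L"
  unfolding pos_kernel_def by (intro arg_cong[where f=All] ext arg_cong[where f="\<lambda>z. z \<in> \<real>\<^sub>\<ge>\<^sub>0"] sum.cong refl)
    (simp add: assms)

lemma pos_kernel_subset:
  assumes "pos_kernel S K" "T \<subseteq> S" "finite S"
  shows "pos_kernel T K"
  unfolding pos_kernel_def
proof
  fix v :: "'a \<Rightarrow> complex"
  let ?v = "\<lambda>i. if i \<in> T then v i else 0"
  have "(\<Sum>i\<in>S. \<Sum>j\<in>S. cnj (?v i) * K i j * ?v j) = (\<Sum>i\<in>T. \<Sum>j\<in>S. cnj (?v i) * K i j * ?v j)"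
    using assms by (intro sum.mono_neutral_right) auto
  also have "\<dots> = (\<Sum>i\<in>T. \<Sum>j\<in>T. cnj (?v i) * K i j * ?v j)"
    using assms by (intro sum.cong refl sum.mono_neutral_right) auto
  also have "\<dots> = (\<Sum>i\<in>T. \<Sum>j\<in>T. cnj (v i) * K i j * v j)"
    by (intro sum.cong refl) auto
  finally show "(\<Sum>i\<in>T. \<Sum>j\<in>T. cnj (v i) * K i j * v j) \<in> \<real>\<^sub>\<ge>\<^sub>0"
    using spec[OF assms(1)[unfolded pos_kernel_def], of ?v] by (simp only:)
qed

lemma pos_kernel_pair:
  assumes "pos_kernel S K" "finite S" "i \<in> S" "j \<in> S" "i \<noteq> j"
  shows "cnj a * K i i * a + cnj a * K i j * b + (cnj b * K j i * a + cnj b * K j j * b) \<in> \<real>\<^sub>\<ge>\<^sub>0"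
proof -
  have "pos_kernel {i, j} K"
    by (rule pos_kernel_subset[of S]) (use assms in auto)
  from spec[OF this[unfolded pos_kernel_def], of "\<lambda>k. if k = i then a else b"]
  show ?thesis using assms(5) by simp
qed

lemma pos_kernel_diag:
  assumes "pos_kernel S K" "finite S" "i \<in> S"
  shows "K i i \<in> \<real>\<^sub>\<ge>\<^sub>0"
proof -
  have "pos_kernel {i} K"
    by (rule pos_kernel_subset[of S]) (use assms in auto)
  from spec[OF this[unfolded pos_kernel_def], of "\<lambda>_. 1"]
  show ?thesis by simp
qed

text \<open>Polarisation: the form is real, and the test vectors (1, 1) and (1, \<i>) on two points
  compare the imaginary and the real parts of the two off-diagonal entries.\<close>

lemma pos_kernel_hermitian:
  assumes "pos_kernel S K" "finite S" "i \<in> S" "j \<in> S"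
  shows "K j i = cnj (K i j)"
proof (cases "i = j")
  case True
  then show ?thesis using pos_kernel_diag[OF assms(1-3)]
    by (simp add: nonneg_Reals_iff complex_eq_iff)
next
  case False
  show ?thesis
    using pos_kernel_pair[OF assms False, of 1 1] pos_kernel_pair[OF assms False, of 1 \<i>]
      pos_kernel_diag[OF assms(1-3)] pos_kernel_diag[OF assms(1,2,4)]
    by (simp add: nonneg_Reals_iff complex_eq_iff)
qed

lemma pos_kernel_zero_diag:
  assumes "pos_kernel S K" "finite S" "i \<in> S" "j \<in> S" "K i i = 0"
  shows "K i j = 0"
proof (rule ccontr)
  assume nz: "K i j \<noteq> 0"
  then have ij: "i \<noteq> j" using assms(5) by auto
  \<comment> \<open>On the test vector with entries \<open>- x * K i j\<close> and 1 the form is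
    affine in \<open>x\<close>, since the quadratic term carries \<open>K i i = 0\<close>. This
    \<open>x\<close> gives it the value -1.\<close>
  define x where "x = (Re (K j j) + 1) / (2 * (cmod (K i j))\<^sup>2)"
  have "K j i = cnj (K i j)" using pos_kernel_hermitian[OF assms(1-4)] .
  then have "0 \<le> Re (K j j) - 2 * x * (cmod (K i j))\<^sup>2"
    using pos_kernel_pair[OF assms(1-4) ij, of "- of_real x * K i j" 1] assms(5)
    unfolding cmod_power2 by (simp add: nonneg_Reals_iff power2_eq_square algebra_simps)
  then show False using nz by (simp add: x_def field_simps)
qed

text \<open>The form becomes a sum of squared moduli. With \<open>U = {()}\<close> this is the
  positivity of rank one kernels.\<close>

lemma pos_kernel_gram:
  assumes "\<And>i j. i \<in> S \<Longrightarrow> j \<in> S \<Longrightarrow> K i j = (\<Sum>u\<in>U. w u i * cnj (w u j))"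
  shows "pos_kernel S K"
  unfolding pos_kernel_def
proof
  fix v :: "'a \<Rightarrow> complex"
  have "(\<Sum>i\<in>S. \<Sum>j\<in>S. cnj (v i) * K i j * v j)
      = (\<Sum>i\<in>S. \<Sum>j\<in>S. \<Sum>u\<in>U. cnj (v i) * w u i * (v j * cnj (w u j)))"
    using assms by (intro sum.cong refl) (simp add: sum_distrib_left mult_ac)
  also have "\<dots> = (\<Sum>u\<in>U. \<Sum>i\<in>S. \<Sum>j\<in>S. cnj (v i) * w u i * (v j * cnj (w u j)))"
    by (subst (2) sum.swap, subst sum.swap) (rule refl)
  also have "\<dots> = (\<Sum>u\<in>U. (\<Sum>i\<in>S. cnj (v i) * w u i) * cnj (\<Sum>i\<in>S. cnj (v i) * w u i))"
    by (simp add: sum_product)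
  also have "\<dots> = of_real (\<Sum>u\<in>U. (cmod (\<Sum>i\<in>S. cnj (v i) * w u i))\<^sup>2)"
    by (simp only: of_real_sum complex_norm_square)
  finally show "(\<Sum>i\<in>S. \<Sum>j\<in>S. cnj (v i) * K i j * v j) \<in> \<real>\<^sub>\<ge>\<^sub>0"
    by (simp only: nonneg_Reals_of_real_iff) (intro sum_nonneg, simp)
qed

text \<open>Cholesky: split off the rank-one kernel \<open>K i s * K s j / K s s\<close>; the Schur complement
  is positive on the remaining points.\<close>

lemma pos_kernel_decomp:
  assumes "finite S" "pos_kernel S K"
  shows "\<exists>w. \<forall>i\<in>S. \<forall>j\<in>S. K i j = (\<Sum>u\<in>S. w u i * cnj (w u j))"
  using assms
proof (induction S arbitrary: K rule: finite_induct)
  case empty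
  then show ?case by simp
next
  case (insert s S)
  let ?S = "insert s S"
  have fin: "finite ?S" using insert by simp
  note pk = insert.prems
  have herm: "K j i = cnj (K i j)" if "i \<in> ?S" "j \<in> ?S" for i j
    using pos_kernel_hermitian[OF pk fin that] .
  obtain k where k: "K s s = of_real k" "k \<ge> 0"
    using pos_kernel_diag[OF pk fin, of s] by (auto elim: nonneg_Reals_cases)
  \<comment> \<open>If \<open>k = 0\<close>, division by zero makes \<open>z\<close> vanish; the row
    of \<open>s\<close> vanishes as well, so \<open>row\<close> holds in both cases.\<close>
  define z where "z i = K i s / of_real (sqrt k)" for i
  define K' where "K' i j = K i j - z i * cnj (z j)" for i j
  have zz: "z i * cnj (z j) = K i s * K s j / of_real k" if "j \<in> ?S" for i j
  proof -
    have "of_real (sqrt k) * of_real (sqrt k) = complex_of_real k"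
      using k by (simp flip: of_real_mult)
    then show ?thesis using herm[of j s] that by (simp add: z_def)
  qed
  have row: "K s j = z s * cnj (z j)" "K j s = z j * cnj (z s)" if "j \<in> ?S" for j
  proof -
    have *: "K s j = z s * cnj (z j)"
    proof (cases "k = 0")
      case True
      then have "K s j = 0" using pos_kernel_zero_diag[OF pk fin, of s j] that k by simp
      then show ?thesis using zz[OF that, of s] True by simp
    next
      case False
      then show ?thesis using zz[OF that, of s] k by simp
    qed
    show "K s j = z s * cnj (z j)" by fact
    show "K j s = z j * cnj (z s)" using * herm[of s j] that by simp
  qed
  have "pos_kernel S K'"
    unfolding pos_kernel_def
  proof
    fix v :: "'a \<Rightarrow> complex"
    define \<beta> where "\<beta> = (\<Sum>j\<in>S. K s j * v j)"
    \<comment> \<open>The value at \<open>s\<close> minimises the form of \<open>K\<close> over all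
      extensions of \<open>v\<close> to \<open>s\<close>; the minimum is the form of the Schur
      complement at \<open>v\<close>.\<close>
    define v' where "v' = v(s := - \<beta> / of_real k)"
    have v': "v' j = v j" if "j \<in> S" for j using that insert by (auto simp: v'_def)
    have \<beta>': "(\<Sum>i\<in>S. cnj (v i) * K i s) = cnj \<beta>"
      unfolding \<beta>_def cnj_sum
    proof (intro sum.cong refl)
      fix i assume "i \<in> S"
      then have "K i s = cnj (K s i)" by (intro herm) auto
      then show "cnj (v i) * K i s = cnj (K s i * v i)" by simp
    qed
    have "(\<Sum>i\<in>?S. \<Sum>j\<in>?S. cnj (v' i) * K i j * v' j)
        = cnj (v' s) * K s s * v' s + (\<Sum>j\<in>S. cnj (v' s) * K s j * v' j)
        + ((\<Sum>i\<in>S. cnj (v' i) * K i s * v' s) + (\<Sum>i\<in>S. \<Sum>j\<in>S. cnj (v' i) * K i j * v' j))"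
      using insert by (simp add: sum.distrib)
    also have "(\<Sum>j\<in>S. cnj (v' s) * K s j * v' j) = cnj (v' s) * \<beta>"
      unfolding \<beta>_def sum_distrib_left by (intro sum.cong refl) (simp add: v' mult_ac)
    also have "(\<Sum>i\<in>S. cnj (v' i) * K i s * v' s) = cnj \<beta> * v' s"
      unfolding \<beta>'[symmetric] sum_distrib_right by (intro sum.cong refl) (simp add: v' mult_ac)
    also have "(\<Sum>i\<in>S. \<Sum>j\<in>S. cnj (v' i) * K i j * v' j) = (\<Sum>i\<in>S. \<Sum>j\<in>S. cnj (v i) * K i j * v j)"
      by (intro sum.cong refl) (simp add: v')
    finally have 1: "(\<Sum>i\<in>?S. \<Sum>j\<in>?S. cnj (v' i) * K i j * v' j)
       = (\<Sum>i\<in>S. \<Sum>j\<in>S. cnj (v i) * K i j * v j) - cnj \<beta> * \<beta> / of_real k"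
      using k by (cases "k = 0") (auto simp: v'_def field_simps)
    have "(\<Sum>i\<in>S. \<Sum>j\<in>S. cnj (v i) * (z i * cnj (z j)) * v j)
        = (\<Sum>i\<in>S. \<Sum>j\<in>S. (cnj (v i) * K i s) * (K s j * v j)) / of_real k"
      unfolding sum_divide_distrib by (intro sum.cong refl) (simp add: zz)
    also have "\<dots> = cnj \<beta> * \<beta> / of_real k"
      unfolding \<beta>'[symmetric] unfolding \<beta>_def by (simp add: sum_product)
    finally have 2: "(\<Sum>i\<in>S. \<Sum>j\<in>S. cnj (v i) * K' i j * v j)
        = (\<Sum>i\<in>S. \<Sum>j\<in>S. cnj (v i) * K i j * v j) - cnj \<beta> * \<beta> / of_real k"
      by (simp add: K'_def algebra_simps sum_subtractf)
    show "(\<Sum>i\<in>S. \<Sum>j\<in>S. cnj (v i) * K' i j * v j) \<in> \<real>\<^sub>\<ge>\<^sub>0"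
      using spec[OF pk[unfolded pos_kernel_def], of v'] unfolding 2 1 .
  qed
  then obtain w where w: "\<forall>i\<in>S. \<forall>j\<in>S. K' i j = (\<Sum>u\<in>S. w u i * cnj (w u j))"
    using insert.IH by blast
  \<comment> \<open>The point \<open>s\<close> also serves as the index of the new factor
    \<open>z\<close>; the old factors are extended by zero to \<open>s\<close>.\<close>
  define w' where "w' u i = (if u = s then z i else if i = s then 0 else w u i)" for u i
  have rest: "(\<Sum>u\<in>S. w' u i * cnj (w' u j)) = (if i = s \<or> j = s then 0 else (\<Sum>u\<in>S. w u i * cnj (w u j)))" for i j
    using insert.hyps by (auto simp: w'_def intro!: sum.neutral sum.cong)
  have "K i j = (\<Sum>u\<in>?S. w' u i * cnj (w' u j))" if "i \<in> ?S" "j \<in> ?S" for i j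
  proof -
    have "(\<Sum>u\<in>?S. w' u i * cnj (w' u j)) = z i * cnj (z j) + (\<Sum>u\<in>S. w' u i * cnj (w' u j))"
      using insert.hyps by (simp add: w'_def)
    also have "\<dots> = K i j"
    proof (cases "i = s \<or> j = s")
      case True
      then show ?thesis unfolding rest using row that by auto
    next
      case False
      then have "K' i j = (\<Sum>u\<in>S. w u i * cnj (w u j))" using w that by auto
      then show ?thesis unfolding rest using False by (simp add: K'_def diff_eq_eq add.commute)
    qed
    finally show ?thesis by simp
  qed
  then show ?case by blast
qed

text \<open>Gram factors simply compose with \<open>f\<close>. Since \<open>f\<close> may identify
  points, this covers repeated rows and columns as well as relabellings.\<close>

lemma pos_kernel_pullback:
  assumes "pos_kernel S K" "finite S" "\<And>i. i \<in> T \<Longrightarrow> f i \<in> S"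
  shows "pos_kernel T (\<lambda>i j. K (f i) (f j))"
proof -
  obtain w where w: "\<forall>i\<in>S. \<forall>j\<in>S. K i j = (\<Sum>u\<in>S. w u i * cnj (w u j))"
    using pos_kernel_decomp[OF assms(2,1)] by blast
  show ?thesis
    by (rule pos_kernel_gram[where U = S and w = "\<lambda>u i. w u (f i)"]) (use w assms(3) in auto)
qed

text \<open>Schur product theorem: the products of the Gram factors of \<open>K\<close> and
  \<open>L\<close> are Gram factors of the entrywise product.\<close>

lemma pos_kernel_mult:
  assumes "pos_kernel S K" "pos_kernel S L" "finite S"
  shows "pos_kernel S (\<lambda>i j. K i j * L i j)"
proof -
  obtain w where w: "\<forall>i\<in>S. \<forall>j\<in>S. K i j = (\<Sum>u\<in>S. w u i * cnj (w u j))"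
    using pos_kernel_decomp[OF assms(3,1)] by blast
  obtain z where z: "\<forall>i\<in>S. \<forall>j\<in>S. L i j = (\<Sum>u\<in>S. z u i * cnj (z u j))"
    using pos_kernel_decomp[OF assms(3,2)] by blast
  show ?thesis
    by (rule pos_kernel_gram[where U = "S \<times> S" and w = "\<lambda>(u, u') i. w u i * z u' i"])
      (use w z in \<open>simp add: sum_product sum.cartesian_product mult_ac case_prod_unfold\<close>)
qed

text \<open>Use test vectors that do not depend on the \<open>U\<close> component.\<close>

lemma pos_kernel_marginal:
  assumes "pos_kernel (I \<times> U) (\<lambda>(i, u) (j, u'). K i u j u')"
  shows "pos_kernel I (\<lambda>i j. \<Sum>u\<in>U. \<Sum>u'\<in>U. K i u j u')"
  unfolding pos_kernel_def
proof
  fix v :: "'a \<Rightarrow> complex"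
  have "(\<Sum>i\<in>I. \<Sum>j\<in>I. cnj (v i) * (\<Sum>u\<in>U. \<Sum>u'\<in>U. K i u j u') * v j)
      = (\<Sum>i\<in>I. \<Sum>j\<in>I. \<Sum>u\<in>U. \<Sum>u'\<in>U. cnj (v i) * K i u j u' * v j)"
    by (simp add: sum_distrib_left sum_distrib_right)
  also have "\<dots> = (\<Sum>i\<in>I. \<Sum>u\<in>U. \<Sum>j\<in>I. \<Sum>u'\<in>U. cnj (v i) * K i u j u' * v j)"
    by (subst (2) sum.swap) simp
  also have "\<dots> = (\<Sum>p\<in>I\<times>U. \<Sum>q\<in>I\<times>U. cnj (v (fst p)) * (\<lambda>(i, u) (j, u'). K i u j u') p q * v (fst q))"
    by (simp add: sum.cartesian_product')
  also have "\<dots> \<in> \<real>\<^sub>\<ge>\<^sub>0"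
    using spec[OF assms[unfolded pos_kernel_def], of "\<lambda>p. v (fst p)"] .
  finally show "(\<Sum>i\<in>I. \<Sum>j\<in>I. cnj (v i) * (\<Sum>u\<in>U. \<Sum>u'\<in>U. K i u j u') * v j) \<in> \<real>\<^sub>\<ge>\<^sub>0" .
qed

text \<open>Pull both kernels back to \<open>I \<times> U\<close>, multiply entrywise and take the
  marginal. In terms of Choi matrices, applying a map to an operator and applying a supermap to a
  map are both sums of this shape.\<close>

lemma pos_kernel_contract:
  assumes "pos_kernel S K" "pos_kernel T L" "finite S" "finite T" "finite I" "finite U"
    and "\<And>i u. i \<in> I \<Longrightarrow> u \<in> U \<Longrightarrow> f i u \<in> S"
    and "\<And>i u. i \<in> I \<Longrightarrow> u \<in> U \<Longrightarrow> g i u \<in> T"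
  shows "pos_kernel I (\<lambda>i j. \<Sum>u\<in>U. \<Sum>u'\<in>U. K (f i u) (f j u') * L (g i u) (g j u'))"
proof (rule pos_kernel_marginal)
  have "pos_kernel (I \<times> U) (\<lambda>p q. K (f (fst p) (snd p)) (f (fst q) (snd q)))"
    by (rule pos_kernel_pullback[of S K]) (use assms in auto)
  moreover have "pos_kernel (I \<times> U) (\<lambda>p q. L (g (fst p) (snd p)) (g (fst q) (snd q)))"
    by (rule pos_kernel_pullback[of T L]) (use assms in auto)
  ultimately have "pos_kernel (I \<times> U) (\<lambda>p q. K (f (fst p) (snd p)) (f (fst q) (snd q)) *
      L (g (fst p) (snd p)) (g (fst q) (snd q)))"
    by (rule pos_kernel_mult) (use assms in auto)
  then show "pos_kernel (I \<times> U) (\<lambda>(i, u) (j, u'). K (f i u) (f j u') * L (g i u) (g j u'))"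
    by (simp add: case_prod_unfold)
qed

section \<open>Matrices and block operators as kernels\<close>

lemma psd_iff_pos_kernel: "psd M \<longleftrightarrow> pos_kernel UNIV (\<lambda>i j. M $ i $ j)"
proof
  assume "psd M"
  then show "pos_kernel UNIV (\<lambda>i j. M $ i $ j)"
    unfolding pos_kernel_def psd_def
    by (intro allI) (drule_tac x = "\<chi> i. v i" in spec, simp)
qed (simp add: psd_def pos_kernel_def)

lemma block_psd_iff_pos_kernel:
  "block_psd K \<rho> \<longleftrightarrow> pos_kernel (K \<times> UNIV) (\<lambda>(k, i) (l, j). \<rho> k l $ i $ j)"
proof -
  have eq: "(\<Sum>p\<in>K\<times>UNIV. \<Sum>q\<in>K\<times>UNIV. cnj (v p) * (\<lambda>(k, i) (l, j). \<rho> k l $ i $ j) p q * v q)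
     = (\<Sum>k\<in>K. \<Sum>l\<in>K. \<Sum>i\<in>UNIV. \<Sum>j\<in>UNIV. cnj (v (k, i)) * \<rho> k l $ i $ j * v (l, j))" for v
    unfolding sum.cartesian_product' by (intro sum.cong refl, subst sum.swap) simp
  show ?thesis
  proof
    assume "block_psd K \<rho>"
    then show "pos_kernel (K \<times> UNIV) (\<lambda>(k, i) (l, j). \<rho> k l $ i $ j)"
      unfolding pos_kernel_def eq block_psd_def
      by (intro allI) (drule_tac x = "\<lambda>k. \<chi> i. v (k, i)" in spec, simp)
  next
    assume *: "pos_kernel (K \<times> UNIV) (\<lambda>(k, i) (l, j). \<rho> k l $ i $ j)"
    show "block_psd K \<rho>"
      unfolding block_psd_def
    proof
      fix v :: "'a \<Rightarrow> complex^'b"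
      show "(\<Sum>k\<in>K. \<Sum>l\<in>K. \<Sum>i\<in>UNIV. \<Sum>j\<in>UNIV. cnj (v k $ i) * \<rho> k l $ i $ j * v l $ j) \<in> \<real>\<^sub>\<ge>\<^sub>0"
        using *[unfolded pos_kernel_def eq, rule_format, of "\<lambda>(k, i). v k $ i"] by simp
    qed
  qed
qed

section \<open>Choi matrices\<close>

text \<open>The inverse Choi correspondence: the partial trace over the input of \<open>J\<close>
  times the tensor product of the transpose of \<rho> with the identity.\<close>

definition unchoi :: "('m::finite \<times> 'n::finite) op \<Rightarrow> ('m, 'n) map" where
  "unchoi J \<rho> = (\<chi> k l. \<Sum>i\<in>UNIV. \<Sum>j\<in>UNIV. \<rho> $ i $ j * J $ (i, k) $ (j, l))"

lemma cscale_nth [simp]: "cscale c M $ i $ j = c * M $ i $ j"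
  by (simp add: cscale_def map_matrix_def)

lemma cscale_zero [simp]: "cscale 0 M = 0" "cscale c 0 = 0"
  by (simp_all add: vec_eq_iff)

lemma choi_nth: "choi \<Phi> $ (i, k) $ (j, l) = \<Phi> (mat_unit i j) $ k $ l"
proof -
  have "choi \<Phi> $ (i, k) $ (j, l) = (\<Sum>a\<in>UNIV. \<Sum>b\<in>UNIV. if i = a then
      (if j = b then \<Phi> (mat_unit i j) $ k $ l else 0) else 0)"
    unfolding choi_def sum_component by (intro sum.cong refl) (auto simp: tensor_def mat_unit_def)
  also have "\<dots> = (\<Sum>a\<in>UNIV. if i = a then \<Phi> (mat_unit i j) $ k $ l else 0)"
    by (intro sum.cong refl) simp
  finally show ?thesis by simp
qed

lemma vector_space_cscale: "vector_space cscale"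
  by standard (auto simp: vec_eq_iff algebra_simps)

lemma lin_maps_iff:
  "\<Phi> \<in> lin_maps \<longleftrightarrow> (\<forall>\<rho> \<sigma>. \<Phi> (\<rho> + \<sigma>) = \<Phi> \<rho> + \<Phi> \<sigma>) \<and> (\<forall>c \<rho>. \<Phi> (cscale c \<rho>) = cscale c (\<Phi> \<rho>))"
  by (auto simp: lin_maps_def Vector_Spaces.linear_iff vector_space_cscale)

lemma lin_maps_sum:
  assumes "\<Phi> \<in> lin_maps"
  shows "\<Phi> (\<Sum>a\<in>A. f a) = (\<Sum>a\<in>A. \<Phi> (f a))"
proof -
  have "\<Phi> 0 = 0"
    using assms[unfolded lin_maps_iff, THEN conjunct2, rule_format, of 0 0] by simp
  then show ?thesis
    using assms by (induction A rule: infinite_finite_induct) (auto simp: lin_maps_iff)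
qed

lemma lin_maps_cscale: "\<Phi> \<in> lin_maps \<Longrightarrow> (\<lambda>\<rho>. cscale c (\<Phi> \<rho>)) \<in> lin_maps"
  by (simp add: lin_maps_iff vec_eq_iff algebra_simps)

lemma lin_maps_expand:
  assumes "\<Phi> \<in> lin_maps"
  shows "\<Phi> \<rho> $ k $ l = (\<Sum>i\<in>UNIV. \<Sum>j\<in>UNIV. \<rho> $ i $ j * choi \<Phi> $ (i, k) $ (j, l))"
proof -
  have "\<rho> = (\<Sum>i\<in>UNIV. \<Sum>j\<in>UNIV. cscale (\<rho> $ i $ j) (mat_unit i j))"
  proof -
    have "(\<Sum>i\<in>UNIV. \<Sum>j\<in>UNIV. cscale (\<rho> $ i $ j) (mat_unit i j)) $ k $ l = \<rho> $ k $ l" for k l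
    proof -
      have "(\<Sum>i\<in>UNIV. \<Sum>j\<in>UNIV. cscale (\<rho> $ i $ j) (mat_unit i j)) $ k $ l
          = (\<Sum>i\<in>UNIV. \<Sum>j\<in>UNIV. if k = i then (if l = j then \<rho> $ k $ l else 0) else 0)"
        unfolding sum_component by (intro sum.cong refl) (auto simp: mat_unit_def)
      also have "\<dots> = (\<Sum>i\<in>UNIV. if k = i then \<rho> $ k $ l else 0)"
        by (intro sum.cong refl) simp
      finally show ?thesis by simp
    qed
    then show ?thesis by (simp add: vec_eq_iff)
  qed
  then have "\<Phi> \<rho> = \<Phi> (\<Sum>i\<in>UNIV. \<Sum>j\<in>UNIV. cscale (\<rho> $ i $ j) (mat_unit i j))"
    by (rule arg_cong)
  also have "\<dots> = (\<Sum>i\<in>UNIV. \<Sum>j\<in>UNIV. cscale (\<rho> $ i $ j) (\<Phi> (mat_unit i j)))"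
    using assms by (simp add: lin_maps_sum[OF assms] lin_maps_iff)
  finally have "\<Phi> \<rho> = (\<Sum>i\<in>UNIV. \<Sum>j\<in>UNIV. cscale (\<rho> $ i $ j) (\<Phi> (mat_unit i j)))" .
  then show ?thesis by (simp add: choi_nth)
qed

lemma unchoi_choi: "\<Phi> \<in> lin_maps \<Longrightarrow> unchoi (choi \<Phi>) = \<Phi>"
  by (simp add: fun_eq_iff vec_eq_iff unchoi_def lin_maps_expand)

lemma unchoi_lin_maps [simp]: "unchoi J \<in> lin_maps"
  by (auto simp: lin_maps_iff vec_eq_iff unchoi_def algebra_simps sum.distrib sum_distrib_left)

lemma choi_unchoi [simp]: "choi (unchoi J) = J"
proof -
  have "choi (unchoi J) $ (i, k) $ (j, l) = J $ (i, k) $ (j, l)" for i k j l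
  proof -
    have "choi (unchoi J) $ (i, k) $ (j, l) = (\<Sum>a\<in>UNIV. \<Sum>b\<in>UNIV. if a = i then
        (if b = j then J $ (i, k) $ (j, l) else 0) else 0)"
      unfolding choi_nth by (auto simp: unchoi_def mat_unit_def intro!: sum.cong)
    also have "\<dots> = (\<Sum>a\<in>UNIV. if a = i then J $ (i, k) $ (j, l) else 0)"
      by (intro sum.cong refl) simp
    finally show ?thesis by simp
  qed
  then show ?thesis by (simp add: vec_eq_iff)
qed

lemma choi_sum: "choi (\<lambda>\<rho>. \<Sum>y\<in>Y. \<Phi> y \<rho>) = (\<Sum>y\<in>Y. choi (\<Phi> y))"
  by (simp add: vec_eq_iff choi_nth)

lemma choi_diff: "choi (\<lambda>\<rho>. \<Phi> \<rho> - \<Psi> \<rho>) = choi \<Phi> - choi \<Psi>"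
  by (simp add: vec_eq_iff choi_nth)

lemma mat_nth: "(mat c :: 'a::zero ^'n^'n) $ i $ j = (if i = j then c else 0)"
  by (simp add: mat_def)

text \<open>\<open>ptrace Pair\<close> traces out the output system, so the matrix equation states
  trace preservation on each matrix unit.\<close>

lemma trace_preserving_iff_choi:
  assumes "\<Phi> \<in> lin_maps"
  shows "trace_preserving \<Phi> \<longleftrightarrow> ptrace Pair (choi \<Phi>) = mat 1"
proof
  assume tp: "trace_preserving \<Phi>"
  have "trace (mat_unit i j :: 'a op) = (if i = j then 1 else 0)" for i j
  proof -
    have "trace (mat_unit i j :: 'a op) = (\<Sum>a\<in>UNIV. if a = i then (if i = j then 1 else 0) else 0)"
      unfolding trace_def mat_unit_def by (intro sum.cong refl) auto
    then show ?thesis by simp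
  qed
  then show "ptrace Pair (choi \<Phi>) = mat 1"
    using tp by (auto simp: vec_eq_iff ptrace_def choi_nth mat_nth trace_preserving_def trace_def)
next
  assume *: "ptrace Pair (choi \<Phi>) = mat 1"
  have m: "(\<Sum>k\<in>UNIV. choi \<Phi> $ (i, k) $ (j, k)) = (if i = j then 1 else 0)" for i j
    using arg_cong[OF *, of "\<lambda>M. M $ i $ j"] by (simp add: ptrace_def mat_nth)
  have "trace (\<Phi> \<rho>) = trace \<rho>" for \<rho>
  proof -
    have "trace (\<Phi> \<rho>) = (\<Sum>k\<in>UNIV. \<Sum>i\<in>UNIV. \<Sum>j\<in>UNIV. \<rho> $ i $ j * choi \<Phi> $ (i, k) $ (j, k))"
      by (simp add: trace_def lin_maps_expand[OF assms])
    also have "\<dots> = (\<Sum>i\<in>UNIV. \<Sum>j\<in>UNIV. \<Sum>k\<in>UNIV. \<rho> $ i $ j * choi \<Phi> $ (i, k) $ (j, k))"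
      by (subst sum.swap, intro sum.cong refl, rule sum.swap)
    also have "\<dots> = trace \<rho>"
      unfolding sum_distrib_left[symmetric] m by (simp add: trace_def if_distrib cong: if_cong)
    finally show ?thesis .
  qed
  then show "trace_preserving \<Phi>" by (simp add: trace_preserving_def)
qed

text \<open>Choi's theorem for maps in \<open>C \<otimes> A\<close>; necessity is seen on the unnormalised maximally
  entangled state of \<open>C\<^sub>0 A\<^sub>0\<close> with an auxiliary system of the same dimension.\<close>

lemma cp_coeffs_iff_pos_kernel:
  fixes N :: "('m::finite, 'n::finite) coeffs"
  assumes lin: "\<And>p q k l. N p q k l \<in> lin_maps"
  shows "cp_coeffs c0 c1 N \<longleftrightarrow>
    pos_kernel ({..<c1} \<times> {..<c0} \<times> UNIV) (\<lambda>(p, k, a) (q, l, a'). choi (N p q k l) $ a $ a')"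
    (is "_ \<longleftrightarrow> pos_kernel ?S ?C")
proof -
  let ?out = "\<lambda>(\<rho> :: nat \<times> nat \<Rightarrow> nat \<times> nat \<Rightarrow> 'm op) (s, p) (t, q). apply_coeffs c0 N (\<lambda>k l. \<rho> (s, k) (t, l)) p q"
  have out: "apply_coeffs c0 N (\<lambda>k l. \<rho> (s, k) (t, l)) p q $ i $ j =
     (\<Sum>u\<in>{..<c0}\<times>UNIV. \<Sum>u'\<in>{..<c0}\<times>UNIV. \<rho> (s, fst u) (t, fst u') $ snd u $ snd u' *
        choi (N p q (fst u) (fst u')) $ (snd u, i) $ (snd u', j))"
    for \<rho> :: "nat \<times> nat \<Rightarrow> nat \<times> nat \<Rightarrow> 'm op" and s t p q i j
    unfolding apply_coeffs_def sum_component lin_maps_expand[OF lin] sum.cartesian_product' fst_conv snd_conv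
    by (intro sum.cong refl, subst sum.swap) simp
  show ?thesis
  proof
    assume C: "pos_kernel ?S ?C"
    have "block_psd ({..<r} \<times> {..<c1}) (?out \<rho>)"
      if \<rho>: "block_psd ({..<r} \<times> {..<c0}) \<rho>" for r \<rho>
    proof -
      have "pos_kernel (({..<r} \<times> {..<c1}) \<times> UNIV) (\<lambda>x y. \<Sum>u\<in>{..<c0}\<times>UNIV. \<Sum>u'\<in>{..<c0}\<times>UNIV.
         (\<lambda>(k, i) (l, j). \<rho> k l $ i $ j) ((\<lambda>((s, p), i) (k, m). ((s, k), m)) x u) ((\<lambda>((s, p), i) (k, m). ((s, k), m)) y u') *
         ?C ((\<lambda>((s, p), i) (k, m). (p, k, (m, i))) x u) ((\<lambda>((s, p), i) (k, m). (p, k, (m, i))) y u'))"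
        by (rule pos_kernel_contract[OF \<rho>[unfolded block_psd_iff_pos_kernel] C]) auto
      then show ?thesis
        unfolding block_psd_iff_pos_kernel
        by (rule iffD1[OF pos_kernel_cong, rotated]) (auto simp: out split_beta)
    qed
    then show "cp_coeffs c0 c1 N" using lin by (simp add: cp_coeffs_def)
  next
    assume cp: "cp_coeffs c0 c1 N"
    \<comment> \<open>Auxiliary systems have initial segments of the naturals as labels, so the
      basis of C_0 A_0 is enumerated by \<open>e\<close>.\<close>
    define r where "r = card ({..<c0} \<times> (UNIV :: 'm set))"
    obtain e where e: "bij_betw e {..<r} ({..<c0} \<times> (UNIV :: 'm set))"
      using ex_bij_betw_nat_finite[of "{..<c0} \<times> (UNIV :: 'm set)"] by (auto simp: r_def atLeast0LessThan)
    define f where "f = inv_into {..<r} e"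
    have f: "e (f x) = x" "f x < r" if "x \<in> {..<c0} \<times> UNIV" for x
      using that e bij_betw_inv_into_right[OF e that] bij_betw_apply[OF bij_betw_inv_into[OF e] that]
      by (auto simp: f_def)
    \<comment> \<open>The rank one operator of the vector that sums |s> (x) |e s> over all s <
      r.\<close>
    define \<rho> :: "nat \<times> nat \<Rightarrow> nat \<times> nat \<Rightarrow> 'm op" where
      "\<rho> x y = (\<chi> m n. (if e (fst x) = (snd x, m) then 1 else 0) * cnj (if e (fst y) = (snd y, n) then 1 else 0))" for x y
    have "block_psd ({..<r} \<times> {..<c0}) \<rho>"
      unfolding block_psd_iff_pos_kernel
      by (rule pos_kernel_gram[where U = "{()}" and w = "\<lambda>_ (x, m). if e (fst x) = (snd x, m) then 1 else 0"])
        (auto simp: \<rho>_def)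
    then have "block_psd ({..<r} \<times> {..<c1}) (?out \<rho>)"
      using cp unfolding cp_coeffs_def by blast
    then have *: "pos_kernel (({..<r} \<times> {..<c1}) \<times> UNIV) (\<lambda>(k, i) (l, j). ?out \<rho> k l $ i $ j)"
      unfolding block_psd_iff_pos_kernel .
    \<comment> \<open>Between the auxiliary labels \<open>f (k, m)\<close> and
      \<open>f (l, n)\<close> the input is a single matrix unit, so the output block there consists
      of entries of one Choi matrix.\<close>
    have "pos_kernel ?S (\<lambda>x y. (\<lambda>(k, i) (l, j). ?out \<rho> k l $ i $ j)
        ((\<lambda>(p, k, (m, i)). ((f (k, m), p), i)) x) ((\<lambda>(p, k, (m, i)). ((f (k, m), p), i)) y))"
      by (rule pos_kernel_pullback[OF *]) (auto intro: f)
    then show "pos_kernel ?S ?C"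
    proof (rule iffD1[OF pos_kernel_cong, rotated], clarsimp simp: out)
      fix p q k l m n i j
      assume kl: "k < c0" "l < c0"
      let ?U = "{..<c0} \<times> (UNIV :: 'm set)"
      have "(\<Sum>u\<in>?U. \<Sum>u'\<in>?U. \<rho> (f (k, m), fst u) (f (l, n), fst u') $ snd u $ snd u' *
            choi (N p q (fst u) (fst u')) $ (snd u, i) $ (snd u', j))
         = (\<Sum>u\<in>?U. \<Sum>u'\<in>?U. if (k, m) = u then (if (l, n) = u' then
            choi (N p q (fst u) (fst u')) $ (snd u, i) $ (snd u', j) else 0) else 0)"
        using kl by (intro sum.cong refl) (auto simp: \<rho>_def f)
      also have "\<dots> = (\<Sum>u\<in>?U. if (k, m) = u then
            choi (N p q (fst u) l) $ (snd u, i) $ (n, j) else 0)"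
        using kl by (intro sum.cong refl) (auto simp: sum.delta')
      also have "\<dots> = choi (N p q k l) $ (m, i) $ (n, j)"
        using kl by (simp add: sum.delta')
      finally show "(\<Sum>u\<in>?U. \<Sum>u'\<in>?U. \<rho> (f (k, m), fst u) (f (l, n), fst u') $ snd u $ snd u' *
            choi (N p q (fst u) (fst u')) $ (snd u, i) $ (snd u', j)) = choi (N p q k l) $ (m, i) $ (n, j)" .
    qed
  qed
qed

lemma block_psd_trivial_factor:
  "block_psd ({..<r} \<times> {..<Suc 0}) \<rho> \<longleftrightarrow> block_psd {..<r} (\<lambda>s t. \<rho> (s, 0) (t, 0))"
  for \<rho> :: "nat \<times> nat \<Rightarrow> nat \<times> nat \<Rightarrow> 'k::finite op"
  unfolding block_psd_iff_pos_kernel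
proof
  assume "pos_kernel (({..<r} \<times> {..<Suc 0}) \<times> UNIV) (\<lambda>(k, i) (l, j). \<rho> k l $ i $ j)"
  then have "pos_kernel ({..<r} \<times> UNIV) (\<lambda>x y. (\<lambda>(k, i) (l, j). \<rho> k l $ i $ j)
     ((\<lambda>(s, i). ((s, 0), i)) x) ((\<lambda>(s, i). ((s, 0), i)) y))"
    by (rule pos_kernel_pullback) auto
  then show "pos_kernel ({..<r} \<times> UNIV) (\<lambda>(s, i) (t, j). \<rho> (s, 0) (t, 0) $ i $ j)"
    by (simp add: case_prod_unfold)
next
  assume "pos_kernel ({..<r} \<times> UNIV) (\<lambda>(s, i) (t, j). \<rho> (s, 0) (t, 0) $ i $ j)"
  then have "pos_kernel (({..<r} \<times> {..<Suc 0}) \<times> UNIV) (\<lambda>x y. (\<lambda>(s, i) (t, j). \<rho> (s, 0) (t, 0) $ i $ j)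
     ((\<lambda>((s, p), i). (s, i)) x) ((\<lambda>((s, p), i). (s, i)) y))"
    by (rule pos_kernel_pullback) auto
  then show "pos_kernel (({..<r} \<times> {..<Suc 0}) \<times> UNIV) (\<lambda>(k, i) (l, j). \<rho> k l $ i $ j)"
    by (rule iffD1[OF pos_kernel_cong, rotated]) auto
qed

text \<open>A map is a coefficient family for the trivial party \<open>C\<close>, so this is the
  case of dimensions 1 and 1 of the criterion for coefficients.\<close>

lemma cp_map_iff_choi:
  fixes \<Phi> :: "('m::finite, 'n::finite) map"
  shows "cp_map \<Phi> \<longleftrightarrow> \<Phi> \<in> lin_maps \<and> psd (choi \<Phi>)"
proof (cases "\<Phi> \<in> lin_maps")
  case lin: True
  have "cp_map \<Phi> \<longleftrightarrow> cp_coeffs 1 1 (\<lambda>_ _ _ _. \<Phi>)"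
  proof
    assume "cp_map \<Phi>"
    then show "cp_coeffs 1 1 (\<lambda>_ _ _ _. \<Phi>)"
      using lin by (auto simp: cp_map_def cp_coeffs_def block_psd_trivial_factor apply_coeffs_def)
  next
    assume cp: "cp_coeffs 1 1 (\<lambda>_ _ _ _. \<Phi>)"
    have "block_psd {..<r} (\<lambda>s t. \<Phi> (\<rho> s t))" if "block_psd {..<r} \<rho>" for r :: nat and \<rho>
    proof -
      have "block_psd ({..<r} \<times> {..<Suc 0}) (\<lambda>x y. \<rho> (fst x) (fst y))"
        using that by (simp add: block_psd_trivial_factor)
      then have "block_psd ({..<r} \<times> {..<Suc 0}) (\<lambda>(s, p) (t, q). apply_coeffs 1 (\<lambda>_ _ _ _. \<Phi>) (\<lambda>k l. \<rho> s t) p q)"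
        using cp unfolding cp_coeffs_def by fastforce
      then show ?thesis by (simp add: block_psd_trivial_factor apply_coeffs_def)
    qed
    then show "cp_map \<Phi>" using lin by (simp add: cp_map_def)
  qed
  also have "\<dots> \<longleftrightarrow> pos_kernel ({..<1::nat} \<times> {..<1::nat} \<times> UNIV) (\<lambda>(p, k, a) (q, l, a'). choi \<Phi> $ a $ a')"
    using lin by (intro cp_coeffs_iff_pos_kernel)
  also have "\<dots> \<longleftrightarrow> psd (choi \<Phi>)"
    unfolding psd_iff_pos_kernel
  proof
    assume "pos_kernel ({..<1::nat} \<times> {..<1::nat} \<times> UNIV) (\<lambda>(p, k, a) (q, l, a'). choi \<Phi> $ a $ a')"
    from pos_kernel_pullback[OF this, of UNIV "\<lambda>a. (0, 0, a)"]
    show "pos_kernel UNIV (\<lambda>i j. choi \<Phi> $ i $ j)" by simp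
  next
    assume "pos_kernel UNIV (\<lambda>i j. choi \<Phi> $ i $ j)"
    then have "pos_kernel ({..<1::nat} \<times> {..<1::nat} \<times> UNIV) (\<lambda>x y. (\<lambda>i j. choi \<Phi> $ i $ j)
       ((\<lambda>(p, k, a). a) x) ((\<lambda>(p, k, a). a) y))"
      by (rule pos_kernel_pullback) auto
    then show "pos_kernel ({..<1::nat} \<times> {..<1::nat} \<times> UNIV) (\<lambda>(p, k, a) (q, l, a'). choi \<Phi> $ a $ a')"
      by (simp add: case_prod_unfold)
  qed
  finally show ?thesis using lin by simp
qed (simp add: cp_map_def)

section \<open>Superchannels\<close>

text \<open>The link product. It is the formula of \<open>unchoi\<close> one level up:
  \<open>J\<close> belongs to a supermap, \<open>X\<close> is the Choi matrix of its argument and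
  the result that of its value.\<close>

definition contract ::
    "('m::finite \<times> 'n::finite) op \<Rightarrow> 'm op \<Rightarrow> 'n op" where
  "contract J X = (\<chi> b b'. \<Sum>a\<in>UNIV. \<Sum>a'\<in>UNIV. J $ (a, b) $ (a', b') * X $ a $ a')"

text \<open>The Choi matrix of the linear map that \<Theta> induces from Choi matrices to Choi
  matrices.\<close>

definition super_choi ::
    "(('a0::finite, 'a1::finite) map \<Rightarrow> ('b0::finite, 'b1::finite) map) \<Rightarrow>
     (('a0 \<times> 'a1) \<times> ('b0 \<times> 'b1)) op" where
  "super_choi \<Theta> = (\<chi> p q. choi (\<Theta> (unchoi (mat_unit (fst p) (fst q)))) $ snd p $ snd q)"

definition super_unchoi ::
    "(('a0::finite \<times> 'a1::finite) \<times> ('b0::finite \<times> 'b1::finite)) op \<Rightarrow>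
     ('a0, 'a1) map \<Rightarrow> ('b0, 'b1) map" where
  "super_unchoi J \<Phi> = unchoi (contract J (choi \<Phi>))"

text \<open>Allowing every scalar \<open>c\<close> turns the affine condition of trace preservation
  into one on a linear space of \<open>X\<close>, which is what a dual description by linear
  equations needs.\<close>

definition superchannel_chois ::
    "(('a0::finite \<times> 'a1::finite) \<times> ('b0::finite \<times> 'b1::finite)) op set" where
  "superchannel_chois = {J. psd J \<and>
     (\<forall>X c. ptrace Pair X = mat c \<longrightarrow> ptrace Pair (contract J X) = mat c)}"

lemma contract_add: "contract J (X + Y) = contract J X + contract J Y"
  by (simp add: contract_def vec_eq_iff algebra_simps sum.distrib)

lemma contract_cscale: "contract J (cscale c X) = cscale c (contract J X)"
  by (simp add: contract_def vec_eq_iff sum_distrib_left mult_ac)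

lemma ptrace_add: "ptrace g (X + Y) = ptrace g X + ptrace g Y"
  by (simp add: ptrace_def vec_eq_iff sum.distrib)

lemma ptrace_cscale: "ptrace g (cscale c X) = cscale c (ptrace g X)"
  by (simp add: ptrace_def vec_eq_iff sum_distrib_left)

lemma linear_supermap_add:
  "linear_supermap \<Theta> \<Longrightarrow> \<Phi> \<in> lin_maps \<Longrightarrow> \<Psi> \<in> lin_maps \<Longrightarrow>
    \<Theta> (\<lambda>\<rho>. \<Phi> \<rho> + \<Psi> \<rho>) = (\<lambda>\<rho>. \<Theta> \<Phi> \<rho> + \<Theta> \<Psi> \<rho>)"
  by (simp add: linear_supermap_def)

lemma linear_supermap_cscale:
  "linear_supermap \<Theta> \<Longrightarrow> \<Phi> \<in> lin_maps \<Longrightarrow>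
    \<Theta> (\<lambda>\<rho>. cscale c (\<Phi> \<rho>)) = (\<lambda>\<rho>. cscale c (\<Theta> \<Phi> \<rho>))"
  by (simp add: linear_supermap_def)

lemma linear_supermap_sum:
  assumes \<Theta>: "linear_supermap \<Theta>" and A: "finite A" and f: "\<And>a. f a \<in> lin_maps"
  shows "\<Theta> (\<lambda>\<rho>. \<Sum>a\<in>A. f a \<rho>) = (\<lambda>\<rho>. \<Sum>a\<in>A. \<Theta> (f a) \<rho>)"
  using A
proof (induction A rule: finite_induct)
  case empty
  \<comment> \<open>The zero map is reached as the multiple by 0 of an arbitrary linear map.\<close>
  have "\<Theta> (\<lambda>\<rho>. cscale 0 (f undefined \<rho>)) = (\<lambda>\<rho>. cscale 0 (\<Theta> (f undefined) \<rho>))"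
    by (rule linear_supermap_cscale[OF \<Theta> f])
  then show ?case by simp
next
  case (insert a A)
  have "(\<lambda>\<rho>. \<Sum>a\<in>A. f a \<rho>) \<in> lin_maps"
    using f unfolding lin_maps_iff by (simp add: sum.distrib vec_eq_iff sum_distrib_left)
  then have "\<Theta> (\<lambda>\<rho>. f a \<rho> + (\<Sum>a\<in>A. f a \<rho>)) = (\<lambda>\<rho>. \<Theta> (f a) \<rho> + \<Theta> (\<lambda>\<rho>. \<Sum>a\<in>A. f a \<rho>) \<rho>)"
    by (rule linear_supermap_add[OF \<Theta> f])
  then show ?case using insert by simp
qed

lemma choi_linear_supermap:
  assumes \<Theta>: "linear_supermap \<Theta>" and \<Phi>: "\<Phi> \<in> lin_maps"
  shows "choi (\<Theta> \<Phi>) = contract (super_choi \<Theta>) (choi \<Phi>)"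
proof -
  let ?E = "\<lambda>p. unchoi (mat_unit (fst p) (snd p))"
  let ?f = "\<lambda>p \<rho>. cscale (choi \<Phi> $ fst p $ snd p) (?E p \<rho>)"
  have "\<Phi> \<rho> = (\<Sum>p\<in>UNIV. ?f p \<rho>)" for \<rho>
  proof -
    have "(\<Sum>p\<in>UNIV. ?f p \<rho>) $ k $ l = \<Phi> \<rho> $ k $ l" for k l
    proof -
      have "(\<Sum>p\<in>UNIV. ?f p \<rho>) $ k $ l =
         (\<Sum>p\<in>UNIV. \<Sum>i\<in>UNIV. \<Sum>j\<in>UNIV. if p = ((i, k), (j, l)) then \<rho> $ i $ j * choi \<Phi> $ (i, k) $ (j, l) else 0)"
        by (auto simp: unchoi_def mat_unit_def sum_distrib_left intro!: sum.cong)
      also have "\<dots> = (\<Sum>i\<in>UNIV. \<Sum>j\<in>UNIV. \<Sum>p\<in>UNIV. if p = ((i, k), (j, l)) then \<rho> $ i $ j * choi \<Phi> $ (i, k) $ (j, l) else 0)"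
        by (subst sum.swap, intro sum.cong refl, rule sum.swap)
      finally show ?thesis by (simp add: lin_maps_expand[OF \<Phi>])
    qed
    then show ?thesis by (simp add: vec_eq_iff)
  qed
  then have "\<Phi> = (\<lambda>\<rho>. \<Sum>p\<in>UNIV. ?f p \<rho>)" by blast
  then have "\<Theta> \<Phi> = \<Theta> (\<lambda>\<rho>. \<Sum>p\<in>UNIV. ?f p \<rho>)" by (rule arg_cong)
  also have "\<dots> = (\<lambda>\<rho>. \<Sum>p\<in>UNIV. \<Theta> (?f p) \<rho>)"
    by (intro linear_supermap_sum[OF \<Theta>] lin_maps_cscale unchoi_lin_maps) simp
  also have "\<dots> = (\<lambda>\<rho>. \<Sum>p\<in>UNIV. cscale (choi \<Phi> $ fst p $ snd p) (\<Theta> (?E p) \<rho>))"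
    by (simp only: linear_supermap_cscale[OF \<Theta> unchoi_lin_maps])
  finally have eq: "\<Theta> \<Phi> = (\<lambda>\<rho>. \<Sum>p\<in>UNIV. cscale (choi \<Phi> $ fst p $ snd p) (\<Theta> (?E p) \<rho>))" .
  show ?thesis
    unfolding eq choi_sum
    by (simp add: vec_eq_iff contract_def super_choi_def choi_nth sum.cartesian_product'[of _ UNIV UNIV, simplified] mult_ac)
qed

text \<open>Choi's argument one level up: \<open>C\<close> is a copy of A, and \<open>N\<close> is
  the element of L^C (x) L^A whose Choi matrix is the rank one operator of the unnormalised
  maximally entangled vector. Up to relabelling, the Choi matrix of its image is
  \<open>super_choi \<Theta>\<close>.\<close>

lemma super_choi_superchannel:
  fixes \<Theta> :: "('a0::finite, 'a1::finite) map \<Rightarrow> ('b0::finite, 'b1::finite) map"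
  assumes \<Theta>: "superchannel \<Theta>"
  shows "super_choi \<Theta> \<in> superchannel_chois"
proof -
  let ?J = "super_choi \<Theta>"
  have lin: "linear_supermap \<Theta>" using \<Theta> by (simp add: superchannel_def)
  obtain e0 :: "nat \<Rightarrow> 'a0" where e0: "bij_betw e0 {..<CARD('a0)} UNIV"
    using ex_bij_betw_nat_finite[of "UNIV :: 'a0 set"] by (auto simp: atLeast0LessThan)
  obtain e1 :: "nat \<Rightarrow> 'a1" where e1: "bij_betw e1 {..<CARD('a1)} UNIV"
    using ex_bij_betw_nat_finite[of "UNIV :: 'a1 set"] by (auto simp: atLeast0LessThan)
  define f0 where "f0 = inv_into {..<CARD('a0)} e0"
  define f1 where "f1 = inv_into {..<CARD('a1)} e1"
  have f0: "e0 (f0 x) = x" "f0 x < CARD('a0)" for x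
    using bij_betw_inv_into_right[OF e0, of x] bij_betw_apply[OF bij_betw_inv_into[OF e0], of x] by (auto simp: f0_def)
  have f1: "e1 (f1 x) = x" "f1 x < CARD('a1)" for x
    using bij_betw_inv_into_right[OF e1, of x] bij_betw_apply[OF bij_betw_inv_into[OF e1], of x] by (auto simp: f1_def)
  define N :: "('a0, 'a1) coeffs" where "N p q k l = unchoi (mat_unit (e0 k, e1 p) (e0 l, e1 q))" for p q k l
  let ?S = "{..<CARD('a1)} \<times> {..<CARD('a0)}"
  have "cp_coeffs CARD('a0) CARD('a1) N"
    by (subst cp_coeffs_iff_pos_kernel, simp add: N_def)
      (rule pos_kernel_gram[where U = "{()}" and w = "\<lambda>_ (p, k, a). if a = (e0 k, e1 p) then 1 else 0"],
        auto simp: N_def mat_unit_def)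
  then have cp: "cp_coeffs CARD('a0) CARD('a1) (\<lambda>p q k l. \<Theta> (N p q k l))"
    using \<Theta> unfolding superchannel_def by blast
  moreover have "\<Theta> (N p q k l) \<in> lin_maps" for p q k l
    using lin by (simp add: linear_supermap_def N_def)
  ultimately have "pos_kernel ({..<CARD('a1)} \<times> {..<CARD('a0)} \<times> UNIV)
      (\<lambda>(p, k, a) (q, l, a'). choi (\<Theta> (N p q k l)) $ a $ a')"
    by (subst (asm) cp_coeffs_iff_pos_kernel) auto
  then have "pos_kernel UNIV (\<lambda>x y. (\<lambda>(p, k, a) (q, l, a'). choi (\<Theta> (N p q k l)) $ a $ a')
      ((\<lambda>((a0, a1), b). (f1 a1, f0 a0, b)) x) ((\<lambda>((a0, a1), b). (f1 a1, f0 a0, b)) y))"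
    by (rule pos_kernel_pullback) (auto simp: f0 f1)
  then have psd: "psd ?J"
    unfolding psd_iff_pos_kernel
    by (rule iffD1[OF pos_kernel_cong, rotated]) (auto simp: N_def f0 f1 super_choi_def)
  have tp1: "ptrace Pair (contract ?J X) = mat 1" if X: "ptrace Pair X = mat 1" for X
  proof -
    have "trace_preserving (unchoi X)" using X by (simp add: trace_preserving_iff_choi)
    then have "trace_preserving (\<Theta> (unchoi X))" "\<Theta> (unchoi X) \<in> lin_maps"
      using \<Theta> lin by (auto simp: superchannel_def linear_supermap_def)
    then show ?thesis
      using choi_linear_supermap[OF lin, of "unchoi X"] by (simp add: trace_preserving_iff_choi)
  qed
  have "ptrace Pair (contract ?J X) = mat c" if X: "ptrace Pair X = mat c" for X c
  proof -
    \<comment> \<open>The Choi matrix of the completely depolarising channel. Adding 1 - c times it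
      changes the marginal from \<open>mat c\<close> to \<open>mat 1\<close>; by linearity its image
      can be subtracted again.\<close>
    define X0 :: "('a0 \<times> 'a1) op" where "X0 = mat (1 / of_nat CARD('a1))"
    have X0: "ptrace Pair X0 = mat 1"
      by (simp add: X0_def ptrace_def vec_eq_iff mat_nth)
    have "ptrace Pair (X + cscale (1 - c) X0) = mat 1"
      by (simp add: ptrace_add ptrace_cscale X X0 vec_eq_iff mat_nth)
    from tp1[OF this] show ?thesis
      by (simp add: contract_add contract_cscale ptrace_add ptrace_cscale tp1[OF X0])
        (simp add: vec_eq_iff mat_nth algebra_simps split: if_splits)
  qed
  then show ?thesis using psd by (simp add: superchannel_chois_def)
qed

lemma choi_super_unchoi: "choi (super_unchoi J \<Phi>) = contract J (choi \<Phi>)"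
  by (simp add: super_unchoi_def)

lemma superchannel_super_unchoi:
  fixes J :: "(('a0::finite \<times> 'a1::finite) \<times> ('b0::finite \<times> 'b1::finite)) op"
  assumes J: "J \<in> superchannel_chois"
  shows "superchannel (super_unchoi J)"
  unfolding superchannel_def
proof (intro conjI allI impI ballI)
  have c1: "choi (\<lambda>\<rho>. \<Phi> \<rho> + \<Psi> \<rho>) = choi \<Phi> + choi \<Psi>" for \<Phi> \<Psi> :: "('a0, 'a1) map"
    by (simp add: vec_eq_iff choi_nth)
  have c2: "choi (\<lambda>\<rho>. cscale c (\<Phi> \<rho>)) = cscale c (choi \<Phi>)" for c and \<Phi> :: "('a0, 'a1) map"
    by (simp add: vec_eq_iff choi_nth)
  have u1: "unchoi (X + Y) = (\<lambda>\<rho>. unchoi X \<rho> + unchoi Y \<rho>)" for X Y :: "('b0 \<times> 'b1) op"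
    by (simp add: fun_eq_iff vec_eq_iff unchoi_def algebra_simps sum.distrib)
  have u2: "unchoi (cscale c X) = (\<lambda>\<rho>. cscale c (unchoi X \<rho>))" for c and X :: "('b0 \<times> 'b1) op"
    by (simp add: fun_eq_iff vec_eq_iff unchoi_def sum_distrib_left mult_ac)
  show "linear_supermap (super_unchoi J)"
    by (simp add: linear_supermap_def super_unchoi_def c1 c2 contract_add contract_cscale u1 u2)
next
  fix c0 c1 and N :: "('a0, 'a1) coeffs"
  assume "cp_coeffs c0 c1 N"
  moreover from this have lin: "N p q k l \<in> lin_maps" for p q k l by (simp add: cp_coeffs_def)
  ultimately have N: "pos_kernel ({..<c1} \<times> {..<c0} \<times> UNIV) (\<lambda>(p, k, a) (q, l, a'). choi (N p q k l) $ a $ a')"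
    by (simp add: cp_coeffs_iff_pos_kernel)
  have psd: "pos_kernel UNIV (\<lambda>i j. J $ i $ j)"
    using J by (simp add: superchannel_chois_def psd_iff_pos_kernel)
  have "pos_kernel ({..<c1} \<times> {..<c0} \<times> UNIV) (\<lambda>x y. \<Sum>u\<in>UNIV. \<Sum>u'\<in>UNIV.
      (\<lambda>i j. J $ i $ j) ((\<lambda>(p, k, b) a. (a, b)) x u) ((\<lambda>(p, k, b) a. (a, b)) y u') *
      (\<lambda>(p, k, a) (q, l, a'). choi (N p q k l) $ a $ a') ((\<lambda>(p, k, b) a. (p, k, a)) x u) ((\<lambda>(p, k, b) a. (p, k, a)) y u'))"
    by (rule pos_kernel_contract[OF psd N]) auto
  then have "pos_kernel ({..<c1} \<times> {..<c0} \<times> UNIV) (\<lambda>(p, k, a) (q, l, a'). choi (super_unchoi J (N p q k l)) $ a $ a')"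
    by (rule iffD1[OF pos_kernel_cong, rotated]) (auto simp: choi_super_unchoi contract_def)
  then show "cp_coeffs c0 c1 (\<lambda>p q k l. super_unchoi J (N p q k l))"
    by (subst cp_coeffs_iff_pos_kernel) (auto simp: super_unchoi_def)
next
  fix \<Phi> :: "('a0, 'a1) map"
  assume "\<Phi> \<in> lin_maps" "trace_preserving \<Phi>"
  then show "trace_preserving (super_unchoi J \<Phi>)"
    using J by (simp add: trace_preserving_iff_choi super_unchoi_def superchannel_chois_def)
qed

section \<open>The real inner product on operators\<close>

definition outer :: "complex^'n::finite \<Rightarrow> 'n op" where
  "outer v = (\<chi> i j. v $ i * cnj (v $ j))"

lemma adj_nth: "adj M $ i $ j = cnj (M $ j $ i)"
  by (simp add: adj_def transpose_def map_matrix_def)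

lemma adj_add: "adj (X + Y) = adj X + adj Y"
  and adj_diff: "adj (X - Y) = adj X - adj Y"
  and adj_scaleR: "adj (c *\<^sub>R X) = c *\<^sub>R adj X"
  by (simp_all add: vec_eq_iff adj_nth)

lemma adj_adj [simp]: "adj (adj M) = M"
  by (simp add: vec_eq_iff adj_nth)

lemma adj_mat_1 [simp]: "adj (mat 1) = mat 1"
  by (auto simp: vec_eq_iff adj_nth mat_nth)

text \<open>Identifies the Euclidean inner product of nested vectors with the Hilbert-Schmidt
  pairing, so that convex geometry and compactness in Euclidean space apply to operators.\<close>

lemma inner_op:
  fixes X Y :: "complex^'n::finite^'m::finite"
  shows "inner X Y = Re (\<Sum>i\<in>UNIV. \<Sum>j\<in>UNIV. cnj (X $ i $ j) * Y $ i $ j)"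
  by (simp add: inner_vec_def inner_complex_def)

lemma inner_adj_adj: "inner (adj X) (adj Y) = inner X Y"
  unfolding inner_op adj_nth by (subst sum.swap) simp

lemma inner_mat_1: "inner (mat 1) X = Re (trace X)"
proof -
  have "(\<Sum>j\<in>UNIV. cnj ((mat 1 :: 'a op) $ i $ j) * X $ i $ j) = X $ i $ i" for i
  proof -
    have "(\<Sum>j\<in>UNIV. cnj ((mat 1 :: 'a op) $ i $ j) * X $ i $ j) = (\<Sum>j\<in>UNIV. if j = i then X $ i $ i else 0)"
      by (intro sum.cong refl) (simp add: mat_nth)
    then show ?thesis by simp
  qed
  then show ?thesis by (simp add: inner_op trace_def)
qed

lemma inner_outer:
  "inner (outer v) M = Re (\<Sum>i\<in>UNIV. \<Sum>j\<in>UNIV. cnj (v $ i) * M $ i $ j * v $ j)"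
  by (simp add: inner_op outer_def mult_ac)

lemma psd_outer [simp]: "psd (outer v)"
  unfolding psd_iff_pos_kernel
  by (rule pos_kernel_gram[where U = "{()}" and w = "\<lambda>_ i. v $ i"]) (simp add: outer_def)

lemma psd_adj:
  assumes "psd M"
  shows "adj M = M"
  unfolding vec_eq_iff adj_nth
  using pos_kernel_hermitian[OF assms[unfolded psd_iff_pos_kernel] finite UNIV_I UNIV_I, symmetric]
  by blast

text \<open>The inner product with \<open>outer v\<close> is only the real part of the quadratic
  form; hermiticity supplies the vanishing of the imaginary part.\<close>

lemma psd_iff_inner: "psd M \<longleftrightarrow> adj M = M \<and> (\<forall>v. 0 \<le> inner (outer v) M)"
proof
  assume "psd M"
  then show "adj M = M \<and> (\<forall>v. 0 \<le> inner (outer v) M)"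
    using psd_adj by (auto simp: inner_outer psd_def nonneg_Reals_iff)
next
  assume *: "adj M = M \<and> (\<forall>v. 0 \<le> inner (outer v) M)"
  show "psd M"
    unfolding psd_def
  proof
    fix v :: "complex^'a"
    let ?q = "\<Sum>i\<in>UNIV. \<Sum>j\<in>UNIV. cnj (v $ i) * M $ i $ j * v $ j"
    have h: "cnj (M $ i $ j) = M $ j $ i" for i j
      using arg_cong[OF conjunct1[OF *], of "\<lambda>A. A $ j $ i"] by (simp add: adj_nth)
    have "cnj ?q = (\<Sum>i\<in>UNIV. \<Sum>j\<in>UNIV. cnj (v $ j) * M $ j $ i * v $ i)"
      by (simp add: h mult_ac)
    also have "\<dots> = ?q" by (rule sum.swap)
    finally have "Im ?q = 0" using Reals_cnj_iff complex_is_Real_iff by blast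
    then show "?q \<in> \<real>\<^sub>\<ge>\<^sub>0"
      using * by (simp add: nonneg_Reals_iff inner_outer)
  qed
qed

lemma psd_gram:
  fixes X :: "'n::finite op"
  assumes "psd X"
  obtains w :: "'n \<Rightarrow> complex^'n" where "X = (\<Sum>u\<in>UNIV. outer (w u))"
proof -
  obtain w :: "'n \<Rightarrow> 'n \<Rightarrow> complex" where "\<forall>i\<in>UNIV. \<forall>j\<in>UNIV. X $ i $ j = (\<Sum>u\<in>UNIV. w u i * cnj (w u j))"
    using pos_kernel_decomp[of UNIV "\<lambda>i j. X $ i $ j"] assms by (auto simp: psd_iff_pos_kernel)
  then have "X = (\<Sum>u\<in>UNIV. outer (\<chi> i. w u i))"
    by (simp add: vec_eq_iff outer_def)
  then show ?thesis by (rule that)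
qed

lemma psd_add: "psd X \<Longrightarrow> psd Y \<Longrightarrow> psd (X + Y)"
  by (simp add: psd_iff_inner adj_add inner_add_right)

lemma psd_zero [simp]: "psd 0"
  by (simp add: psd_def)

lemma psd_sum: "(\<And>i. i \<in> A \<Longrightarrow> psd (f i)) \<Longrightarrow> psd (\<Sum>i\<in>A. f i)"
  by (induction A rule: infinite_finite_induct) (auto intro: psd_add)

lemma psd_scaleR: "0 \<le> c \<Longrightarrow> psd X \<Longrightarrow> psd (c *\<^sub>R X)"
  by (simp add: psd_iff_inner adj_scaleR)

text \<open>Write \<open>X\<close> as a sum of \<open>outer\<close> matrices; each of them pairs
  with \<open>Y\<close> to a value of its form. Weak duality rests on this.\<close>

lemma inner_psd_nonneg:
  assumes "psd X" "psd Y"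
  shows "0 \<le> inner X Y"
  using assms(1)
proof (rule psd_gram)
  fix w assume "X = (\<Sum>u\<in>UNIV. outer (w u))"
  then show ?thesis
    using assms(2) by (auto simp: inner_sum_left psd_iff_inner intro!: sum_nonneg)
qed

lemma inner_outer_mat_1: "inner (outer v) (mat 1) = (norm v)\<^sup>2"
proof -
  have "inner (outer v) (mat 1) = (\<Sum>i\<in>UNIV. Re (v $ i * cnj (v $ i)))"
    by (subst inner_commute) (simp add: inner_mat_1 trace_def outer_def)
  also have "\<dots> = inner v v"
    by (simp add: inner_vec_def inner_complex_def)
  finally show ?thesis by (simp add: power2_norm_eq_inner)
qed

lemma norm_outer: "norm (outer v) = (norm v)\<^sup>2"
proof -
  have v: "(\<Sum>i\<in>UNIV. v $ i * cnj (v $ i)) = of_real ((norm v)\<^sup>2)"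
    unfolding power2_norm_eq_inner inner_vec_def of_real_sum
    by (intro sum.cong refl) (simp add: complex_eq_iff inner_complex_def)
  have "inner (outer v) (outer v) = Re (\<Sum>i\<in>UNIV. \<Sum>j\<in>UNIV. (v $ i * cnj (v $ i)) * (v $ j * cnj (v $ j)))"
    by (simp add: inner_op outer_def mult_ac)
  also have "\<dots> = ((norm v)\<^sup>2)\<^sup>2"
    unfolding sum_product[symmetric] v by (simp add: power2_eq_square)
  finally have "(norm (outer v))\<^sup>2 = ((norm v)\<^sup>2)\<^sup>2" by (simp add: power2_norm_eq_inner)
  then show ?thesis by (rule power2_eq_imp_eq) simp_all
qed

text \<open>Triangle inequality over the Gram factors: a rank one term has its trace as norm.
  Boundedness of every compact set below comes from here.\<close>

lemma norm_psd_le_trace: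
  assumes "psd X"
  shows "norm X \<le> Re (trace X)"
  using assms
proof (rule psd_gram)
  fix w assume w: "X = (\<Sum>u\<in>UNIV. outer (w u))"
  have "norm X \<le> (\<Sum>u\<in>UNIV. norm (outer (w u)))"
    unfolding w by (rule norm_sum)
  also have "\<dots> = inner (mat 1) X"
    unfolding w inner_sum_right by (intro sum.cong refl) (simp add: norm_outer inner_outer_mat_1 inner_commute[of "mat 1"])
  finally show ?thesis by (simp add: inner_mat_1)
qed

text \<open>By Cauchy-Schwarz the Hilbert-Schmidt norm dominates the operator norm. The bound
  supplies a feasible point in \<open>psd_duality\<close> and the tilted family in
  \<open>conditional_chois_separate\<close>.\<close>

lemma psd_scaled_identity_minus:
  assumes "adj H = H" "norm H \<le> c"
  shows "psd (c *\<^sub>R mat 1 - H)"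
proof -
  have "inner (outer v) H \<le> c * (norm v)\<^sup>2" for v
  proof -
    have "inner (outer v) H \<le> norm (outer v) * norm H" by (rule norm_cauchy_schwarz)
    also have "\<dots> \<le> (norm v)\<^sup>2 * c" unfolding norm_outer using assms by (intro mult_left_mono) auto
    finally show ?thesis by (simp add: mult.commute)
  qed
  then show ?thesis
    using assms by (simp add: psd_iff_inner adj_diff adj_scaleR inner_diff_right inner_outer_mat_1)
qed

lemma continuous_on_adj [continuous_intros]:
  "continuous_on S f \<Longrightarrow> continuous_on S (\<lambda>x. adj (f x))"
  by (rule bounded_linear.continuous_on) (simp_all add: linear_conv_bounded_linear[symmetric] linearI adj_add adj_scaleR)

lemma closed_psd: "closed {M. psd M}"
proof -
  have "{M :: 'a op. psd M} = {M. adj M = M} \<inter> (\<Inter>v. {M. 0 \<le> inner (outer v) M})"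
    by (auto simp: psd_iff_inner)
  also have "closed \<dots>"
    by (intro closed_Int closed_INT ballI closed_Collect_eq closed_Collect_le continuous_intros)
  finally show ?thesis .
qed

section \<open>Conic duality\<close>

text \<open>The minimum of the trace over the feasible \<open>X\<close> is attained by compactness.
  The slacks \<open>X - M\<close> with smaller trace then miss the cone, and a functional separating
  them from it, rescaled, is \<open>J\<close>. On \<open>W\<close> it must be a multiple of the
  trace, because the set of these slacks is invariant under translation by traceless elements of
  \<open>W\<close>.\<close>

lemma psd_duality:
  fixes W :: "'n::finite op set"
  assumes sub: "subspace W" and adjW: "\<And>X. X \<in> W \<Longrightarrow> adj X \<in> W" and one: "mat 1 \<in> W"
    and M: "adj M = M"
  obtains X J where "X \<in> W" "psd (X - M)" "psd J" "\<And>Y. Y \<in> W \<Longrightarrow> inner J Y = Re (trace Y)"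
    "Re (trace X) \<le> inner J M"
proof -
  define tr :: "'n op \<Rightarrow> real" where "tr = inner (mat 1)"
  have tr: "tr X = Re (trace X)" for X by (simp add: tr_def inner_mat_1)
  have tr_lin: "tr (X + Y) = tr X + tr Y" "tr (X - Y) = tr X - tr Y" "tr (c *\<^sub>R X) = c * tr X" for X Y c
    by (simp_all add: tr_def inner_add_right inner_diff_right)
  have tr_adj: "tr (adj X) = tr X" for X
    using inner_adj_adj[of "mat 1" X] by (simp add: tr_def)
  define n where "n = real CARD('n)"
  have n: "n > 0" by (simp add: n_def)
  have tr1: "tr (mat 1) = n"
    by (simp add: tr n_def trace_def mat_nth)
  note subI = subspace_add[OF sub] subspace_diff[OF sub] subspace_scale[OF sub] one

  \<comment> \<open>A feasible point; cutting the feasible set at its trace makes that set bounded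
    without losing the optimum.\<close>
  define X1 :: "'n op" where "X1 = norm M *\<^sub>R mat 1"
  define G where "G = {X \<in> W. psd (X - M) \<and> tr X \<le> tr X1}"
  have X1: "X1 \<in> G"
    using M by (auto simp: G_def X1_def intro: subI psd_scaled_identity_minus)
  have "closed G"
  proof -
    have "G = W \<inter> (\<lambda>X. X - M) -` {X. psd X} \<inter> {X. tr X \<le> tr X1}"
      by (auto simp: G_def)
    moreover have "closed ((\<lambda>X. X - M) -` {X. psd X})"
      by (intro closed_vimage closed_psd continuous_intros)
    ultimately show ?thesis
      using closed_subspace[OF sub] unfolding tr_def
      by (auto intro!: closed_Int closed_Collect_le continuous_intros)
  qed
  moreover have "bounded G"
    unfolding bounded_iff
  proof (intro exI ballI)
    fix X assume X: "X \<in> G"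
    have "norm X \<le> norm (X - M) + norm M"
      using norm_triangle_ineq[of "X - M" M] by simp
    also have "norm (X - M) \<le> tr (X - M)"
      using X by (auto simp: G_def tr intro: norm_psd_le_trace)
    also have "tr (X - M) \<le> tr X1 - tr M"
      using X by (simp add: G_def tr_lin)
    finally show "norm X \<le> tr X1 - tr M + norm M" by simp
  qed
  ultimately have "compact G" by (simp add: compact_eq_bounded_closed)
  moreover have "continuous_on G tr" unfolding tr_def by (intro continuous_intros)
  ultimately obtain X0 where X0: "X0 \<in> G" and min: "\<And>X. X \<in> G \<Longrightarrow> tr X0 \<le> tr X"
    using continuous_attains_inf[of G tr] X1 by blast
  have X0W: "X0 \<in> W" and X0M: "psd (X0 - M)" and X01: "tr X0 \<le> tr X1"
    using X0 by (auto simp: G_def)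
  have min: "tr X0 \<le> tr X" if "X \<in> W" "psd (X - M)" for X
    using min[of X] that X01 by (cases "tr X \<le> tr X1") (auto simp: G_def)

  define S where "S = {X - M |X. X \<in> W \<and> tr X < tr X0}"
  \<comment> \<open>Adding the antihermitian operators forces a separating functional to be hermitian.\<close>
  define T :: "'n op set" where "T = {Y. psd (Y + adj Y)}"
  \<comment> \<open>These are the elements of \<open>S\<close> on which the functional gets tested:
    \<open>X0\<close> lowered a little along the identity and moved freely in traceless
    directions.\<close>
  have below: "X0 - e *\<^sub>R mat 1 + Y - M \<in> S" if "e > 0" "Y \<in> W" "tr Y = 0" for e Y
    unfolding S_def using that n by (auto intro!: exI[of _ "X0 - e *\<^sub>R mat 1 + Y"] subI X0W simp: tr_lin tr1)
  have "convex S"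
  proof (rule convexI)
    fix x y and u v :: real
    assume xy: "x \<in> S" "y \<in> S" and uv: "0 \<le> u" "0 \<le> v" "u + v = 1"
    from xy obtain X Y where XY: "x = X - M" "y = Y - M" "X \<in> W" "Y \<in> W" "tr X < tr X0" "tr Y < tr X0"
      by (auto simp: S_def)
    have "u *\<^sub>R x + v *\<^sub>R y = (u *\<^sub>R X + v *\<^sub>R Y) - M"
      using uv by (simp add: XY algebra_simps flip: scaleR_add_left)
    moreover have "u *\<^sub>R X + v *\<^sub>R Y \<in> W" by (intro subI XY)
    moreover have "tr (u *\<^sub>R X + v *\<^sub>R Y) < tr X0"
      using convex_bound_lt[OF XY(5,6) uv] by (simp add: tr_lin)
    ultimately show "u *\<^sub>R x + v *\<^sub>R y \<in> S" unfolding S_def by blast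
  qed
  moreover have scaleT: "c *\<^sub>R Y \<in> T" if "Y \<in> T" "c \<ge> 0" for c Y
    using psd_scaleR[of c "Y + adj Y"] that by (simp add: T_def adj_scaleR algebra_simps)
  moreover have "convex T"
  proof (rule convexI)
    fix x y and u v :: real
    assume "x \<in> T" "y \<in> T" "0 \<le> u" "0 \<le> v" "u + v = 1"
    then have "psd (u *\<^sub>R (x + adj x) + v *\<^sub>R (y + adj y))"
      unfolding T_def by (intro psd_add[OF psd_scaleR psd_scaleR]) auto
    then show "u *\<^sub>R x + v *\<^sub>R y \<in> T"
      by (simp add: T_def adj_add adj_scaleR algebra_simps)
  qed
  moreover have "S \<noteq> {}" using below[of 1 0] subspace_0[OF sub] by (auto simp: tr_def)
  moreover have T0: "0 \<in> T" by (simp add: T_def adj_def transpose_def map_matrix_def flip: zero_vec_def)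
  moreover have "S \<inter> T = {}"
  proof -
    have False if X: "X \<in> W" "tr X < tr X0" and T: "psd ((X - M) + adj (X - M))" for X
    proof -
      \<comment> \<open>The hermitian part stays in \<open>W\<close>, keeps the trace and is
        feasible, which contradicts the minimality of \<open>X0\<close>.\<close>
      let ?X = "(1/2) *\<^sub>R (X + adj X)"
      have "?X - M = (1/2) *\<^sub>R ((X - M) + adj (X - M))"
        using M by (simp add: adj_diff vec_eq_iff scaleR_conv_of_real[where 'a = complex] field_simps)
      then have "psd (?X - M)" using psd_scaleR[OF _ T, of "1/2"] by simp
      moreover have "?X \<in> W" by (intro subI adjW X)
      ultimately show False using min[of ?X] X by (simp add: tr_lin tr_adj)
    qed
    then show ?thesis by (auto simp: S_def T_def)
  qed
  ultimately obtain a b where a: "a \<noteq> 0" and aS: "\<And>x. x \<in> S \<Longrightarrow> inner a x \<le> b"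
    and aT: "\<And>x. x \<in> T \<Longrightarrow> b \<le> inner a x"
    using separating_hyperplane_sets[of S T] by (metis empty_iff)
  have b: "b \<le> 0" using aT[OF T0] by simp
  have aT: "0 \<le> inner a x" if "x \<in> T" for x
  proof (rule ccontr)
    assume neg: "\<not> 0 \<le> inner a x"
    \<comment> \<open>\<open>T\<close> is a cone, and scaling by \<open>?t\<close> would produce the
      value b - 1 there.\<close>
    let ?t = "(b - 1) / inner a x"
    have "?t \<ge> 0" using neg b by (simp add: divide_nonpos_neg)
    from aT[OF scaleT[OF that this]] show False using neg by simp
  qed
  have herm: "adj a = a"
  proof -
    \<comment> \<open>\<open>?K\<close> is antihermitian, so \<open>T\<close> contains it with both
      signs; moreover \<open>inner ?K ?K\<close> is twice \<open>inner a ?K\<close>.\<close>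
    let ?K = "a - adj a"
    have "?K \<in> T" "- ?K \<in> T" by (auto simp: T_def adj_diff)
    then have "inner a ?K = 0" using aT[of ?K] aT[of "- ?K"] by (simp add: inner_diff_right)
    then have "inner ?K ?K = 0"
      using inner_adj_adj[of a a] by (simp add: inner_diff_right inner_diff_left inner_commute)
    then show ?thesis by simp
  qed
  have "outer v \<in> T" for v
    using psd_add[OF psd_outer psd_outer, of v v] psd_adj[OF psd_outer, of v] by (simp add: T_def)
  then have psd_a: "psd a"
    using herm aT by (simp add: psd_iff_inner inner_commute[of "outer _" a])
  define c where "c = tr a"
  \<comment> \<open>Strict feasibility enters here: \<open>a\<close> is positive and nonzero, so it
    cannot vanish at the identity, which lies in \<open>W\<close>.\<close>
  have c: "c > 0"
    using norm_psd_le_trace[OF psd_a] a by (simp add: c_def tr) (meson less_le_trans zero_less_norm_iff)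
  have a1: "inner a (mat 1) = c" by (simp add: c_def tr_def inner_commute)
  have ker: "inner a Y = 0" if Y: "Y \<in> W" "tr Y = 0" for Y
  proof (rule ccontr)
    assume nz: "inner a Y \<noteq> 0"
    let ?Z = "X0 - 1 *\<^sub>R mat 1 - M"
    \<comment> \<open>This \<open>t\<close> brings the value to 1, whereas on \<open>S\<close> it is
      at most b, hence at most 0.\<close>
    define t where "t = (1 - inner a ?Z) / inner a Y"
    have "inner a (X0 - 1 *\<^sub>R mat 1 + t *\<^sub>R Y - M) \<le> b"
      by (rule aS[OF below]) (use Y in \<open>auto intro: subI simp: tr_lin\<close>)
    moreover have "inner a (X0 - 1 *\<^sub>R mat 1 + t *\<^sub>R Y - M) = inner a ?Z + t * inner a Y"
      by (simp add: algebra_simps inner_diff_right inner_add_right)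
    ultimately show False using nz b by (simp add: t_def)
  qed
  have aW: "inner a Y = c / n * tr Y" if "Y \<in> W" for Y
    using ker[of "Y - (tr Y / n) *\<^sub>R mat 1"] that n
    by (simp add: subI tr_lin tr1 inner_diff_right a1)
  \<comment> \<open>The scale is the one for which \<open>J\<close> and the trace agree at the
    identity.\<close>
  define J where "J = (n / c) *\<^sub>R a"
  show ?thesis
  proof
    show "X0 \<in> W" "psd (X0 - M)" by fact+
    show "psd J" using psd_a n c by (simp add: J_def psd_scaleR)
    show "inner J Y = Re (trace Y)" if "Y \<in> W" for Y
      using aW[OF that] n c by (simp add: J_def tr)
    show "Re (trace X0) \<le> inner J M"
    proof (rule field_le_epsilon)
      fix e :: real assume e: "e > 0"
      \<comment> \<open>\<open>X0 - M\<close> lies only on the boundary of \<open>S\<close>; it is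
        approached by points whose trace is lower by e.\<close>
      have "inner a (X0 - (e / n) *\<^sub>R mat 1 + 0 - M) \<le> b"
        by (rule aS[OF below]) (use e n subspace_0[OF sub] in \<open>auto simp: tr_def\<close>)
      then have "inner a X0 - e / n * c \<le> inner a M"
        using b by (simp add: inner_diff_right a1)
      then have "(n / c) * (inner a X0 - e / n * c) \<le> (n / c) * inner a M"
        using n c by (intro mult_left_mono) auto
      then show "Re (trace X0) \<le> inner J M + e"
        using n c aW[OF X0W] by (simp add: J_def tr right_diff_distrib)
    qed
  qed
qed

section \<open>Support functions\<close>

text \<open>A maximum of linear functions with uniformly bounded coefficients is Lipschitz, hence
  continuous. Applied to the maximal payoff as a function of \<Lambda>.\<close>

lemma support_function_attains_inf:
  fixes S T :: "'a::real_inner set"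
  assumes S: "compact S" and T: "compact T" "T \<noteq> {}"
    and h: "\<And>t. t \<in> T \<Longrightarrow> \<exists>s\<in>S. h t = inner s t" "\<And>s t. s \<in> S \<Longrightarrow> t \<in> T \<Longrightarrow> inner s t \<le> h t"
  shows "\<exists>t\<in>T. \<forall>t'\<in>T. h t \<le> h t'"
proof -
  obtain C where C: "\<And>s. s \<in> S \<Longrightarrow> norm s \<le> C" "C > 0"
    using compact_imp_bounded[OF S] unfolding bounded_pos by blast
  have le: "h t - h t' \<le> C * dist t t'" if t: "t \<in> T" "t' \<in> T" for t t'
  proof -
    obtain s where s: "s \<in> S" "h t = inner s t" using h(1) t by blast
    have "h t - h t' \<le> inner s (t - t')"
      using s h(2)[of s t'] t by (simp add: inner_diff_right)
    also have "\<dots> \<le> norm s * norm (t - t')" by (rule norm_cauchy_schwarz)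
    also have "\<dots> \<le> C * norm (t - t')" using C s by (intro mult_right_mono) auto
    finally show ?thesis by (simp add: dist_norm)
  qed
  have "C-lipschitz_on T h"
  proof (rule lipschitz_onI)
    show "dist (h x) (h y) \<le> C * dist x y" if "x \<in> T" "y \<in> T" for x y
      using le[of x y] le[of y x] that by (simp add: dist_real_def abs_le_iff dist_commute)
  qed (use C in simp)
  then have "continuous_on T h" by (rule lipschitz_on_continuous_on)
  then show ?thesis using continuous_attains_inf[of T h] T by blast
qed

section \<open>Duality for superchannels\<close>

lemma sum_UNIV_prod:
  fixes f :: "'a \<times> 'b \<Rightarrow> 'c::comm_monoid_add"
  shows "(\<Sum>p\<in>UNIV. f p) = (\<Sum>a\<in>UNIV. \<Sum>b\<in>UNIV. f (a, b))"
  using sum.cartesian_product'[of f UNIV UNIV] by simp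

definition lift_B1 :: "(('a::finite \<times> 'b0::finite) op) \<Rightarrow> ('a \<times> ('b0 \<times> 'b1::finite)) op" where
  "lift_B1 \<gamma> = reindex (\<lambda>(a, b0, b1). ((a, b0), b1)) (\<gamma> \<otimes> (mat 1 :: 'b1 op))"

definition dual_ops :: "((('a0::finite \<times> 'a1::finite) \<times> 'b0::finite) op) set" where
  "dual_ops = {\<gamma>. ptrace (\<lambda>(a0, b0) a1. ((a0, a1), b0)) \<gamma> =
     (uniform :: 'a0 op) \<otimes> ptrace (\<lambda>b0 a. (a, b0)) \<gamma>}"

lemma lift_B1_nth:
  "lift_B1 \<gamma> $ (a, b0, b1) $ (a', b0', b1') = (if b1 = b1' then \<gamma> $ (a, b0) $ (a', b0') else 0)"
  by (simp add: lift_B1_def reindex_def tensor_def mat_nth)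

lemma lift_B1_add: "lift_B1 (X + Y) = lift_B1 X + lift_B1 Y"
  and lift_B1_scaleR: "lift_B1 (c *\<^sub>R X) = c *\<^sub>R lift_B1 X"
  and lift_B1_adj: "lift_B1 (adj X) = adj (lift_B1 X)"
  and lift_B1_mat_1: "lift_B1 (mat 1) = mat 1"
  by (auto simp: vec_eq_iff lift_B1_nth adj_nth mat_nth)

lemma linear_lift_B1: "linear lift_B1"
  by (rule linearI) (simp_all add: lift_B1_add lift_B1_scaleR)

lemma lift_B1_inject: "lift_B1 X = lift_B1 Y \<Longrightarrow> X = Y"
  by (auto simp: vec_eq_iff lift_B1_nth) (metis (full_types))

lemma trace_lift_B1: "trace (lift_B1 \<gamma> :: ('a::finite \<times> ('b0::finite \<times> 'b1::finite)) op) = of_nat CARD('b1) * trace \<gamma>"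
  by (simp add: trace_def sum_UNIV_prod lift_B1_nth sum_distrib_left)

lemma dual_ops_iff:
  fixes \<gamma> :: "(('a0::finite \<times> 'a1::finite) \<times> 'b0::finite) op"
  shows "\<gamma> \<in> dual_ops \<longleftrightarrow> (\<forall>i j b b'. (\<Sum>k\<in>UNIV. \<gamma> $ ((i, k), b) $ ((j, k), b')) =
    (if i = j then (\<Sum>a\<in>UNIV. \<gamma> $ (a, b) $ (a, b')) / of_nat CARD('a0) else 0))"
  by (auto simp: dual_ops_def vec_eq_iff ptrace_def tensor_def uniform_def mat_nth)

lemma subspace_dual_ops: "subspace dual_ops"
  by (auto simp: subspace_def dual_ops_iff sum.distrib add_divide_distrib sum_distrib_left[symmetric]
      scaleR_conv_of_real[where 'a = complex])

lemma adj_dual_ops: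
  assumes "\<gamma> \<in> dual_ops"
  shows "adj \<gamma> \<in> dual_ops"
  unfolding dual_ops_iff adj_nth cnj_sum[symmetric]
  using assms unfolding dual_ops_iff by (simp add: cnj_sum)

lemma mat_1_dual_ops: "mat 1 \<in> dual_ops"
  by (auto simp: dual_ops_iff mat_nth)

lemma inner_lift_B1:
  "inner J (lift_B1 \<gamma>) = Re (\<Sum>b\<in>UNIV. \<Sum>b'\<in>UNIV. \<Sum>k\<in>UNIV. \<Sum>a\<in>UNIV. \<Sum>a'\<in>UNIV.
     cnj (J $ (a, b, k) $ (a', b', k)) * \<gamma> $ (a, b) $ (a', b'))"
proof -
  let ?t = "\<lambda>a b k a' b'. cnj (J $ (a, b, k) $ (a', b', k)) * \<gamma> $ (a, b) $ (a', b')"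
  have "inner J (lift_B1 \<gamma>) = Re (\<Sum>a\<in>UNIV. \<Sum>b\<in>UNIV. \<Sum>k\<in>UNIV. \<Sum>a'\<in>UNIV. \<Sum>b'\<in>UNIV. ?t a b k a' b')"
    unfolding inner_op sum_UNIV_prod lift_B1_nth
    by (simp add: if_distrib[where f = "\<lambda>x. _ * x"] cong: if_cong)
  also have "(\<Sum>a\<in>UNIV. \<Sum>b\<in>UNIV. \<Sum>k\<in>UNIV. \<Sum>a'\<in>UNIV. \<Sum>b'\<in>UNIV. ?t a b k a' b')
     = (\<Sum>b\<in>UNIV. \<Sum>a\<in>UNIV. \<Sum>k\<in>UNIV. \<Sum>a'\<in>UNIV. \<Sum>b'\<in>UNIV. ?t a b k a' b')"
    by (rule sum.swap)
  also have "\<dots> = (\<Sum>b\<in>UNIV. \<Sum>k\<in>UNIV. \<Sum>a\<in>UNIV. \<Sum>a'\<in>UNIV. \<Sum>b'\<in>UNIV. ?t a b k a' b')"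
    by (rule sum.cong[OF refl], rule sum.swap)
  also have "\<dots> = (\<Sum>b\<in>UNIV. \<Sum>k\<in>UNIV. \<Sum>a\<in>UNIV. \<Sum>b'\<in>UNIV. \<Sum>a'\<in>UNIV. ?t a b k a' b')"
    by (rule sum.cong[OF refl], rule sum.cong[OF refl], rule sum.cong[OF refl], rule sum.swap)
  also have "\<dots> = (\<Sum>b\<in>UNIV. \<Sum>k\<in>UNIV. \<Sum>b'\<in>UNIV. \<Sum>a\<in>UNIV. \<Sum>a'\<in>UNIV. ?t a b k a' b')"
    by (rule sum.cong[OF refl], rule sum.cong[OF refl], rule sum.swap)
  also have "\<dots> = (\<Sum>b\<in>UNIV. \<Sum>b'\<in>UNIV. \<Sum>k\<in>UNIV. \<Sum>a\<in>UNIV. \<Sum>a'\<in>UNIV. ?t a b k a' b')"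
    by (rule sum.cong[OF refl], rule sum.swap)
  finally show ?thesis .
qed

text \<open>The operators \<open>X \<otimes> Z\<close> with \<open>X\<close> the Choi matrix of a trace preserving map span \<open>dual_ops\<close>, so
  preservation of trace preservation is a family of linear equations for the Choi matrix.\<close>

lemma superchannel_chois_iff:
  fixes J :: "(('a0::finite \<times> 'a1::finite) \<times> ('b0::finite \<times> 'b1::finite)) op"
  shows "J \<in> superchannel_chois \<longleftrightarrow>
    psd J \<and> (\<forall>\<gamma>\<in>dual_ops. inner J (lift_B1 \<gamma>) = Re (trace \<gamma>) / real CARD('a0))"
    (is "_ \<longleftrightarrow> _ \<and> ?D")
proof -
  let ?n = "of_nat CARD('a0) :: complex"
  have ?D if J: "J \<in> superchannel_chois"
  proof
    fix \<gamma> :: "(('a0 \<times> 'a1) \<times> 'b0) op" assume \<gamma>: "\<gamma> \<in> dual_ops"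
    \<comment> \<open>By condition 2 each block of \<gamma> with respect to B_0 has a multiple of
      the identity as marginal, so the condition on \<open>J\<close> applies to it. The conjugation
      compensates the one in the inner product.\<close>
    define X where "X b b' = (\<chi> a a'. cnj (\<gamma> $ (a, b) $ (a', b')))" for b b'
    define c where "c b b' = cnj (\<Sum>a\<in>UNIV. \<gamma> $ (a, b) $ (a, b')) / ?n" for b b'
    have "ptrace Pair (X b b') = mat (c b b')" for b b'
      using \<gamma> by (simp add: vec_eq_iff ptrace_def X_def mat_nth dual_ops_iff cnj_sum[symmetric] c_def del: cnj_sum)
    then have "ptrace Pair (contract J (X b b')) = mat (c b b')" for b b'
      using J by (simp add: superchannel_chois_def)
    then have "(\<Sum>k\<in>UNIV. contract J (X b b') $ (b, k) $ (b', k)) = (if b = b' then c b b' else 0)" for b b'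
      by (simp add: vec_eq_iff ptrace_def mat_nth)
    then have 1: "(\<Sum>k\<in>UNIV. \<Sum>a\<in>UNIV. \<Sum>a'\<in>UNIV. J $ (a, b, k) $ (a', b', k) * cnj (\<gamma> $ (a, b) $ (a', b'))) =
        (if b = b' then c b b' else 0)" for b b'
      by (simp add: contract_def X_def)
    have "inner J (lift_B1 \<gamma>) = Re (cnj (\<Sum>b\<in>UNIV. \<Sum>b'\<in>UNIV. \<Sum>k\<in>UNIV. \<Sum>a\<in>UNIV. \<Sum>a'\<in>UNIV.
       J $ (a, b, k) $ (a', b', k) * cnj (\<gamma> $ (a, b) $ (a', b'))))"
      unfolding inner_lift_B1 by simp
    also have "\<dots> = Re (\<Sum>b\<in>UNIV. cnj (c b b))"
      unfolding 1 by simp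
    also have "(\<Sum>b\<in>UNIV. cnj (c b b)) = trace \<gamma> / ?n"
      unfolding trace_def sum_UNIV_prod[where 'b = 'b0] by (simp add: c_def sum_divide_distrib[symmetric]) (rule sum.swap)
    finally show "inner J (lift_B1 \<gamma>) = Re (trace \<gamma>) / real CARD('a0)" by simp
  qed
  moreover have "ptrace Pair (contract J X) = mat c" if D: ?D and X: "ptrace Pair X = mat c" for X c
  proof -
    have X': "(\<Sum>k\<in>UNIV. cnj (X $ (a, k) $ (a', k))) = (if a = a' then cnj c else 0)" for a a'
      using arg_cong[OF X, of "\<lambda>M. cnj (M $ a $ a')"] by (simp add: ptrace_def mat_nth)
    have X'': "(\<Sum>p\<in>UNIV. cnj (X $ p $ p)) = ?n * cnj c"
      by (simp add: sum_UNIV_prod X')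
    have "(\<Sum>k\<in>UNIV. contract J X $ (i, k) $ (j, k)) = (if i = j then c else 0)" (is "?S = ?c") for i j
    proof -
      have z: "Re (z * cnj ?S) = Re (z * cnj ?c)" for z
      proof -
        \<comment> \<open>\<gamma> carries \<open>z\<close> times the conjugate of \<open>X\<close>
          in the single block (i, j) of B_0. The values 1 and \<i> of \<open>z\<close> yield the
          real and the imaginary part of the equation.\<close>
        define w where "w b b' = (if b = i then if b' = j then z else 0 else 0)" for b b'
        define \<gamma> :: "(('a0 \<times> 'a1) \<times> 'b0) op" where
          "\<gamma> = (\<chi> p q. w (snd p) (snd q) * cnj (X $ fst p $ fst q))"
        have \<gamma>: "\<gamma> \<in> dual_ops"
          by (simp add: dual_ops_iff \<gamma>_def sum_distrib_left[symmetric] X' X'')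
        have "trace \<gamma> = (\<Sum>b\<in>UNIV. w b b * (?n * cnj c))"
          unfolding trace_def sum_UNIV_prod[where 'b = 'b0]
          by (subst sum.swap) (simp add: \<gamma>_def sum_distrib_left[symmetric] X'')
        also have "\<dots> = (\<Sum>b\<in>UNIV. if b = i then (if i = j then z * (?n * cnj c) else 0) else 0)"
          by (intro sum.cong refl) (auto simp: w_def)
        finally have tr: "trace \<gamma> = (if i = j then z * (?n * cnj c) else 0)"
          by simp
        have "(\<Sum>k\<in>UNIV. \<Sum>a\<in>UNIV. \<Sum>a'\<in>UNIV. cnj (J $ (a, b, k) $ (a', b', k)) * \<gamma> $ (a, b) $ (a', b')) =
            (if b = i then if b' = j then \<Sum>k\<in>UNIV. \<Sum>a\<in>UNIV. \<Sum>a'\<in>UNIV.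
              cnj (J $ (a, i, k) $ (a', j, k)) * (z * cnj (X $ a $ a')) else 0 else 0)" for b b'
          by (simp add: \<gamma>_def w_def)
        then have "inner J (lift_B1 \<gamma>) = Re (\<Sum>b\<in>UNIV. if b = i then (\<Sum>b'\<in>UNIV. if b' = j then
            \<Sum>k\<in>UNIV. \<Sum>a\<in>UNIV. \<Sum>a'\<in>UNIV. cnj (J $ (a, i, k) $ (a', j, k)) * (z * cnj (X $ a $ a')) else 0) else 0)"
          unfolding inner_lift_B1 by (intro arg_cong[where f = Re] sum.cong refl) (simp del: sum.delta sum.delta')
        also have "\<dots> = Re (\<Sum>k\<in>UNIV. \<Sum>a\<in>UNIV. \<Sum>a'\<in>UNIV. cnj (J $ (a, i, k) $ (a', j, k)) * (z * cnj (X $ a $ a')))"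
          by simp
        also have "\<dots> = Re (z * cnj ?S)"
          by (simp add: contract_def sum_distrib_left mult_ac)
        finally have "Re (z * cnj ?S) = Re (trace \<gamma>) / real CARD('a0)"
          using D \<gamma> by simp
        also have "trace \<gamma> = ?n * (z * cnj ?c)" using tr by simp
        also have "Re \<dots> / real CARD('a0) = Re (z * cnj ?c)"
          by (simp only: times_complex.sel(1)[of ?n] complex_Re_of_nat complex_Im_of_nat) simp
        finally show ?thesis .
      qed
      have "cnj ?S = cnj ?c" using z[of 1] z[of \<i>] by (simp add: complex_eq_iff)
      then show ?thesis by (simp only: complex_cnj_cancel_iff)
    qed
    then show ?thesis by (simp add: vec_eq_iff ptrace_def mat_nth)
  qed
  ultimately show ?thesis unfolding superchannel_chois_def by blast
qed

section \<open>Tensor products, transposes and contractions of operators\<close>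

lemma psd_tensor:
  assumes "psd X" "psd Y"
  shows "psd (X \<otimes> Y)"
proof -
  have "pos_kernel UNIV (\<lambda>p q. X $ fst p $ fst q)" "pos_kernel UNIV (\<lambda>p q. Y $ snd p $ snd q)"
    using pos_kernel_pullback[of UNIV "\<lambda>i j. X $ i $ j" UNIV fst] pos_kernel_pullback[of UNIV "\<lambda>i j. Y $ i $ j" UNIV snd]
      assms by (auto simp: psd_iff_pos_kernel)
  then have "pos_kernel UNIV (\<lambda>p q. X $ fst p $ fst q * Y $ snd p $ snd q)"
    by (rule pos_kernel_mult) simp
  then show ?thesis
    unfolding psd_iff_pos_kernel by (rule iffD1[OF pos_kernel_cong, rotated]) (simp add: tensor_def)
qed

lemma psd_transpose:
  assumes "psd X"
  shows "psd (transpose X)"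
proof -
  have eq: "(\<Sum>i\<in>UNIV. \<Sum>j\<in>UNIV. cnj (v $ i) * transpose X $ i $ j * v $ j)
      = (\<Sum>i\<in>UNIV. \<Sum>j\<in>UNIV. cnj ((\<chi> k. cnj (v $ k)) $ i) * X $ i $ j * (\<chi> k. cnj (v $ k)) $ j)" for v
    by (subst sum.swap) (simp add: transpose_def mult_ac)
  show ?thesis
    unfolding psd_def
  proof
    fix v
    show "(\<Sum>i\<in>UNIV. \<Sum>j\<in>UNIV. cnj (v $ i) * transpose X $ i $ j * v $ j) \<in> \<real>\<^sub>\<ge>\<^sub>0"
      unfolding eq using assms[unfolded psd_def] by (rule spec)
  qed
qed

lemma psd_contract:
  assumes "psd J" "psd X"
  shows "psd (contract J X)"
proof -
  have "pos_kernel UNIV (\<lambda>b b'. \<Sum>a\<in>UNIV. \<Sum>a'\<in>UNIV. (\<lambda>p q. J $ p $ q) ((\<lambda>b a. (a, b)) b a) ((\<lambda>b a. (a, b)) b' a') *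
      (\<lambda>p q. X $ p $ q) ((\<lambda>b a. a) b a) ((\<lambda>b a. a) b' a'))"
    by (rule pos_kernel_contract[OF assms[unfolded psd_iff_pos_kernel]]) auto
  then show ?thesis by (simp add: psd_iff_pos_kernel contract_def)
qed

text \<open>The inner product conjugates \<open>X\<close> along with \<open>J\<close>, and for
  hermitian \<open>X\<close> the conjugate is the transpose. This is the origin of the transpose in
  condition 1.\<close>

lemma inner_contract:
  assumes "adj X = X"
  shows "inner (contract J X) Y = inner J (transpose X \<otimes> Y)"
proof -
  have X: "cnj (X $ a $ a') = X $ a' $ a" for a a'
    using arg_cong[OF assms, of "\<lambda>M. M $ a' $ a"] by (simp add: adj_nth)
  let ?t = "\<lambda>b b' a a'. cnj (J $ (a, b) $ (a', b')) * (X $ a' $ a * Y $ b $ b')"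
  have "cnj (contract J X $ b $ b') * Y $ b $ b' = (\<Sum>a\<in>UNIV. \<Sum>a'\<in>UNIV. ?t b b' a a')" for b b'
    by (simp add: contract_def X sum_distrib_right sum_distrib_left mult_ac)
  then have "inner (contract J X) Y = Re (\<Sum>b\<in>UNIV. \<Sum>b'\<in>UNIV. \<Sum>a\<in>UNIV. \<Sum>a'\<in>UNIV. ?t b b' a a')"
    unfolding inner_op by presburger
  also have "(\<Sum>b\<in>UNIV. \<Sum>b'\<in>UNIV. \<Sum>a\<in>UNIV. \<Sum>a'\<in>UNIV. ?t b b' a a')
     = (\<Sum>b\<in>UNIV. \<Sum>a\<in>UNIV. \<Sum>b'\<in>UNIV. \<Sum>a'\<in>UNIV. ?t b b' a a')"
    by (rule sum.cong[OF refl], rule sum.swap)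
  also have "\<dots> = (\<Sum>b\<in>UNIV. \<Sum>a\<in>UNIV. \<Sum>a'\<in>UNIV. \<Sum>b'\<in>UNIV. ?t b b' a a')"
    by (rule sum.cong[OF refl], rule sum.cong[OF refl], rule sum.swap)
  also have "\<dots> = (\<Sum>a\<in>UNIV. \<Sum>b\<in>UNIV. \<Sum>a'\<in>UNIV. \<Sum>b'\<in>UNIV. ?t b b' a a')"
    by (rule sum.swap)
  also have "Re \<dots> = inner J (transpose X \<otimes> Y)"
    by (simp add: inner_op sum_UNIV_prod tensor_def transpose_def)
  finally show ?thesis .
qed

text \<open>Pair \<open>J\<close> with the positive slack; both terms carry the same factor
  1/d_A0.\<close>

lemma superchannel_weak_duality:
  fixes J :: "(('a0::finite \<times> 'a1::finite) \<times> ('b0::finite \<times> 'b1::finite)) op"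
  assumes "J \<in> superchannel_chois" "\<gamma> \<in> dual_ops"
    and "psd (lift_B1 \<gamma> - (1 / real CARD('a0)) *\<^sub>R M)"
  shows "inner J M \<le> Re (trace \<gamma>)"
proof -
  have "psd J" "inner J (lift_B1 \<gamma>) = Re (trace \<gamma>) / real CARD('a0)"
    using assms by (auto simp: superchannel_chois_iff)
  then show ?thesis
    using inner_psd_nonneg[OF _ assms(3), of J] by (simp add: inner_diff_right field_simps)
qed

text \<open>\<open>psd_duality\<close> is applied to the operators \<gamma> (x) I with \<gamma> in
  \<open>dual_ops\<close>. The \<open>J'\<close> obtained pairs with them to d_B1 Tr \<gamma>, so
  division by d_A0 d_B1 gives the normalisation of a superchannel; scaling \<gamma> by 1/d_A0
  matches condition 1.\<close>

lemma superchannel_strong_duality: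
  fixes M :: "(('a0::finite \<times> 'a1::finite) \<times> ('b0::finite \<times> 'b1::finite)) op"
  assumes M: "adj M = M"
  obtains J \<gamma> where "J \<in> superchannel_chois" "\<gamma> \<in> dual_ops" "hermitian \<gamma>"
    "psd (lift_B1 \<gamma> - (1 / real CARD('a0)) *\<^sub>R M)" "Re (trace \<gamma>) = inner J M"
proof -
  let ?a = "real CARD('a0)" and ?b = "real CARD('b1)"
  let ?W = "(lift_B1 :: _ \<Rightarrow> (('a0 \<times> 'a1) \<times> ('b0 \<times> 'b1)) op) ` dual_ops"
  have "subspace ?W"
    by (rule linear_subspace_image[OF linear_lift_B1 subspace_dual_ops])
  moreover have "adj X \<in> ?W" if "X \<in> ?W" for X
    using that by (auto intro!: imageI adj_dual_ops simp flip: lift_B1_adj)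
  moreover have "mat 1 \<in> ?W"
    using mat_1_dual_ops by (metis lift_B1_mat_1 imageI)
  ultimately obtain X J' where X: "X \<in> ?W" "psd (X - M)" and J': "psd J'"
    "\<And>Y. Y \<in> ?W \<Longrightarrow> inner J' Y = Re (trace Y)" and le: "Re (trace X) \<le> inner J' M"
    using psd_duality[of ?W M] M by blast
  obtain \<gamma>' where \<gamma>': "\<gamma>' \<in> dual_ops" "X = lift_B1 \<gamma>'" using X by blast
  define J where "J = (1 / (?a * ?b)) *\<^sub>R J'"
  define \<gamma> where "\<gamma> = (1 / ?a) *\<^sub>R \<gamma>'"
  have tr: "Re (trace \<gamma>) = Re (trace \<gamma>') / ?a"
    by (simp add: \<gamma>_def trace_def scaleR_sum_right[symmetric])
  have J: "J \<in> superchannel_chois"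
    using J' by (auto simp: superchannel_chois_iff J_def psd_scaleR trace_lift_B1)
  have \<gamma>: "\<gamma> \<in> dual_ops"
    unfolding \<gamma>_def using \<gamma>' by (intro subspace_scale subspace_dual_ops)
  have p: "psd (lift_B1 \<gamma> - (1 / ?a) *\<^sub>R M)"
    using psd_scaleR[OF _ X(2), of "1 / ?a"] by (simp add: \<gamma>' \<gamma>_def lift_B1_scaleR scaleR_diff_right)
  \<comment> \<open>Hermiticity of \<gamma> is inherited from the slack and from
    \<open>M\<close>.\<close>
  have "adj (lift_B1 \<gamma> :: (('a0 \<times> 'a1) \<times> ('b0 \<times> 'b1)) op) = lift_B1 \<gamma>"
    using psd_adj[OF p] M by (simp add: adj_diff adj_scaleR)
  then have "hermitian \<gamma>"
    unfolding hermitian_def lift_B1_adj[symmetric] by (rule lift_B1_inject)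
  moreover have "Re (trace \<gamma>) \<le> inner J M"
    using le by (simp add: tr J_def \<gamma>' trace_lift_B1 field_simps)
  ultimately show ?thesis
    using that J \<gamma> p superchannel_weak_duality[OF J \<gamma> p] by force
qed

text \<open>The equation for \<gamma> = \<open>mat 1\<close> fixes the trace of \<open>J\<close>,
  and for positive \<open>J\<close> the trace bounds the norm.\<close>

lemma compact_superchannel_chois:
  "compact (superchannel_chois :: (('a0::finite \<times> 'a1::finite) \<times> ('b0::finite \<times> 'b1::finite)) op set)"
    (is "compact ?C")
proof -
  have "?C = {J. psd J} \<inter> (\<Inter>\<gamma>\<in>dual_ops. {J. inner J (lift_B1 \<gamma>) = Re (trace \<gamma>) / real CARD('a0)})"
    by (auto simp: superchannel_chois_iff)
  also have "closed \<dots>"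
    by (intro closed_Int closed_psd closed_INT ballI closed_Collect_eq continuous_intros)
  finally have "closed ?C" .
  moreover have "bounded ?C"
    unfolding bounded_iff
  proof (intro exI ballI)
    fix J assume J: "J \<in> ?C"
    have "norm J \<le> inner J (mat 1)"
      using J norm_psd_le_trace[of J] by (simp add: superchannel_chois_iff inner_commute[of J] inner_mat_1)
    also have "\<dots> = Re (trace (mat 1 :: (('a0 \<times> 'a1) \<times> 'b0) op)) / real CARD('a0)"
      using J mat_1_dual_ops unfolding superchannel_chois_iff lift_B1_mat_1[symmetric] by blast
    finally show "norm J \<le> Re (trace (mat 1 :: (('a0 \<times> 'a1) \<times> 'b0) op)) / real CARD('a0)" .
  qed
  ultimately show ?thesis by (simp add: compact_eq_bounded_closed)
qed

lemma convex_superchannel_chois: "convex superchannel_chois"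
  by (auto simp: convex_def superchannel_chois_iff inner_add_left psd_add psd_scaleR simp flip: distrib_right add_divide_distrib)

text \<open>The optimal \<open>J\<close> of strong duality, here for \<open>M = 0\<close>, is a
  point of the set.\<close>

lemma superchannel_chois_nonempty: "superchannel_chois \<noteq> {}"
  by (rule superchannel_strong_duality[of 0]) (auto simp: vec_eq_iff adj_nth)

section \<open>Conditional families of Choi matrices\<close>

text \<open>Nested vectors instead of functions, so that families form a Euclidean space with inner
  product and topology.\<close>

type_synonym ('x, 'y, 'n) op_family = "(('n op)^'y)^'x"

definition choi_family ::
    "('x::finite \<Rightarrow> 'y::finite \<Rightarrow> ('m::finite, 'n::finite) map) \<Rightarrow> ('x, 'y, 'm \<times> 'n) op_family" where
  "choi_family \<Lambda> = (\<chi> x y. choi (\<Lambda> x y))"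

definition conditional_chois :: "('x::finite, 'y::finite, 'm::finite \<times> 'n::finite) op_family set" where
  "conditional_chois = {L. (\<forall>x y. psd (L $ x $ y)) \<and> (\<forall>x. ptrace Pair (\<Sum>y\<in>UNIV. L $ x $ y) = mat 1)}"

lemma conditional_family_iff:
  "conditional_family \<Lambda> \<longleftrightarrow> (\<forall>x y. \<Lambda> x y \<in> lin_maps) \<and> choi_family \<Lambda> \<in> conditional_chois"
proof -
  have lin: "(\<lambda>\<rho>. \<Sum>y\<in>UNIV. \<Lambda> x y \<rho>) \<in> lin_maps" if "\<forall>x y. \<Lambda> x y \<in> lin_maps" for x
    using that by (auto simp: lin_maps_iff sum.distrib vec_eq_iff sum_distrib_left)
  show ?thesis
    unfolding conditional_family_def cp_map_iff_choi
    using lin by (auto simp: choi_family_def conditional_chois_def choi_sum trace_preserving_iff_choi intro: psd_sum)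
qed

lemma trace_ptrace: "trace (ptrace Pair X) = trace X"
  by (simp add: trace_def ptrace_def sum_UNIV_prod)

lemma ptrace_diff: "ptrace g (X - Y) = ptrace g X - ptrace g Y"
  by (simp add: vec_eq_iff ptrace_def sum_subtractf)

lemma ptrace_scaleR: "ptrace g (c *\<^sub>R X) = c *\<^sub>R ptrace g X"
  by (simp add: vec_eq_iff ptrace_def scaleR_sum_right)

lemma continuous_on_ptrace [continuous_intros]:
  "continuous_on S f \<Longrightarrow> continuous_on S (\<lambda>x. ptrace g (f x))"
  by (rule bounded_linear.continuous_on)
    (simp_all add: linear_conv_bounded_linear[symmetric] linearI ptrace_add ptrace_scaleR)

lemma norm_vec_le_sum: "norm x \<le> (\<Sum>i\<in>UNIV. norm (x $ i))"
  unfolding norm_vec_def by (rule L2_set_le_sum) simp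

lemma compact_conditional_chois:
  "compact (conditional_chois :: ('x::finite, 'y::finite, 'm::finite \<times> 'n::finite) op_family set)"
    (is "compact ?T")
proof -
  have "?T = (\<Inter>x. \<Inter>y. (\<lambda>L. L $ x $ y) -` {X. psd X}) \<inter>
     (\<Inter>x. {L. ptrace Pair (\<Sum>y\<in>UNIV. L $ x $ y) = mat 1})"
    by (auto simp: conditional_chois_def)
  also have "closed \<dots>"
    by (intro closed_Int closed_INT ballI closed_vimage closed_psd closed_Collect_eq continuous_intros)
  finally have "closed ?T" .
  moreover have "bounded ?T"
    unfolding bounded_iff
  proof (intro exI ballI)
    fix L assume L: "L \<in> ?T"
    have "norm L \<le> (\<Sum>x\<in>UNIV. \<Sum>y\<in>UNIV. norm (L $ x $ y))"
      by (rule order_trans[OF norm_vec_le_sum]) (intro sum_mono norm_vec_le_sum)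
    also have "\<dots> \<le> (\<Sum>x\<in>UNIV. \<Sum>y\<in>UNIV. Re (trace (L $ x $ y)))"
      using L by (intro sum_mono norm_psd_le_trace) (auto simp: conditional_chois_def)
    also have "\<dots> = (\<Sum>x\<in>UNIV. Re (trace (\<Sum>y\<in>UNIV. L $ x $ y)))"
      by (simp flip: inner_mat_1 add: inner_sum_right)
    also have "\<dots> = (\<Sum>x\<in>(UNIV::'x set). Re (trace (mat 1 :: 'm op)))"
      using L by (intro sum.cong refl) (simp add: conditional_chois_def flip: trace_ptrace)
    finally show "norm L \<le> (\<Sum>x\<in>(UNIV::'x set). Re (trace (mat 1 :: 'm op)))" .
  qed
  ultimately show ?thesis by (simp add: compact_eq_bounded_closed)
qed

definition contract_family ::
    "('x::finite, 'y::finite, 'm::finite) op_family \<Rightarrow> ('m \<times> 'n::finite) op \<Rightarrow> ('x, 'y, 'n) op_family" where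
  "contract_family F J = (\<chi> x y. contract J (F $ x $ y))"

lemma contract_sum: "contract J (\<Sum>i\<in>A. f i) = (\<Sum>i\<in>A. contract J (f i))"
proof -
  have "contract J 0 = 0" by (simp add: vec_eq_iff contract_def)
  then show ?thesis
    by (induction A rule: infinite_finite_induct) (auto simp: contract_add)
qed

lemma linear_contract_family: "linear (contract_family F)"
  by (rule linearI) (simp_all add: vec_eq_iff contract_family_def contract_def algebra_simps sum.distrib scaleR_sum_right)

lemma contract_family_conditional:
  assumes "J \<in> superchannel_chois" "F \<in> conditional_chois"
  shows "contract_family F J \<in> conditional_chois"
  using assms by (auto simp: conditional_chois_def contract_family_def superchannel_chois_def
      psd_contract simp flip: contract_sum)

text \<open>Up to constants the right-hand side of condition 1. It represents the payoff against
  \<open>L\<close> as a linear functional of \<open>J\<close>.\<close>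

definition pairing_op :: "('x::finite, 'y::finite, 'm::finite) op_family \<Rightarrow> ('x, 'y, 'n::finite) op_family \<Rightarrow> ('m \<times> 'n) op" where
  "pairing_op F L = (\<Sum>x\<in>UNIV. \<Sum>y\<in>UNIV. transpose (F $ x $ y) \<otimes> L $ x $ y)"

lemma inner_op_family: "inner A L = (\<Sum>x\<in>UNIV. \<Sum>y\<in>UNIV. inner (A $ x $ y) (L $ x $ y))"
  for A L :: "('x::finite, 'y::finite, 'n::finite) op_family"
  by (rule trans[OF inner_vec_def], rule sum.cong[OF refl], rule inner_vec_def)

lemma inner_pairing_op:
  assumes "F \<in> conditional_chois"
  shows "inner J (pairing_op F L) = inner (contract_family F J) L"
proof -
  have "adj (F $ x $ y) = F $ x $ y" for x y
    using assms psd_adj by (auto simp: conditional_chois_def)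
  then show ?thesis
    by (simp add: pairing_op_def inner_sum_right inner_op_family contract_family_def inner_contract)
qed

section \<open>The payoff and the semidefinite program\<close>

lemma cq_op_entry:
  "cq_op M $ p $ q = (if fst p = fst q \<and> fst (snd p) = fst (snd q)
     then of_real (1 / real CARD('x)) * M (fst p) (fst (snd p)) $ snd (snd p) $ snd (snd q) else 0)"
  for M :: "'x::finite \<Rightarrow> 'y::finite \<Rightarrow> 'n::finite op"
  using cq_op_nth[of M "fst p" "fst (snd p)" "snd (snd p)" "fst q" "fst (snd q)" "snd (snd q)"] by simp

text \<open>Only blocks with equal classical labels meet, and each argument contributes a factor
  1/d_X; hence the d_X^2 in condition 1.\<close>

lemma inner_cq_op:
  fixes M N :: "'x::finite \<Rightarrow> 'y::finite \<Rightarrow> 'n::finite op"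
  shows "inner (cq_op M) (cq_op N) =
    1 / (real CARD('x))\<^sup>2 * (\<Sum>x\<in>UNIV. \<Sum>y\<in>UNIV. inner (M x y) (N x y))"
proof -
  let ?c = "1 / (real CARD('x))\<^sup>2"
  have "inner (cq_op M $ (x, y, i)) (cq_op N $ (x, y, i)) = ?c * inner (M x y $ i) (N x y $ i)" for x y i
  proof -
    have "inner (cq_op M $ (x, y, i) $ (x', y', j)) (cq_op N $ (x, y, i) $ (x', y', j)) =
        (if x = x' then if y = y' then ?c * inner (M x y $ i $ j) (N x y $ i $ j) else 0 else 0)" for x' y' j
      by (auto simp: cq_op_nth inner_complex_def power2_eq_square field_simps)
    then have "inner (cq_op M $ (x, y, i)) (cq_op N $ (x, y, i)) = (\<Sum>x'\<in>UNIV. \<Sum>y'\<in>UNIV. \<Sum>j\<in>UNIV.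
        if x = x' then if y = y' then ?c * inner (M x y $ i $ j) (N x y $ i $ j) else 0 else 0)"
      unfolding inner_vec_def[of "_ $ (_, _)"] sum_UNIV_prod by presburger
    also have "\<dots> = (\<Sum>x'\<in>UNIV. \<Sum>y'\<in>UNIV. if x = x' then if y = y' then
        \<Sum>j\<in>UNIV. ?c * inner (M x y $ i $ j) (N x y $ i $ j) else 0 else 0)"
      by (intro sum.cong refl) simp
    also have "\<dots> = (\<Sum>x'\<in>UNIV. if x = x' then \<Sum>j\<in>UNIV. ?c * inner (M x y $ i $ j) (N x y $ i $ j) else 0)"
      by (intro sum.cong refl) simp
    also have "\<dots> = ?c * inner (M x y $ i) (N x y $ i)"
      by (simp add: inner_vec_def sum_distrib_left)
    finally show ?thesis .
  qed
  then show ?thesis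
    unfolding inner_vec_def[of "cq_op M"] sum_UNIV_prod
    by (simp add: inner_vec_def[of "M _ _"] sum_distrib_left)
qed

lemma inner_choi_cq_map:
  fixes \<Phi> \<Psi> :: "'x::finite \<Rightarrow> 'y::finite \<Rightarrow> ('m::finite, 'n::finite) map"
  shows "inner (choi (cq_map \<Phi>)) (choi (cq_map \<Psi>)) =
    1 / (real CARD('x))\<^sup>2 * inner (choi_family \<Phi>) (choi_family \<Psi>)"
proof -
  \<comment> \<open>The input system is the first factor of \<open>choi (cq_map \<Phi>)\<close> but
    follows X and Y in \<open>cq_choi \<Phi>\<close>; \<open>?g\<close> permutes the tensor factors
    accordingly.\<close>
  let ?g = "\<lambda>p :: 'm \<times> 'x \<times> 'y \<times> 'n. (fst (snd p), fst (snd (snd p)), fst p, snd (snd (snd p)))"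
  have g: "bij ?g"
    by (rule o_bij[where g = "\<lambda>p. (fst (snd (snd p)), fst p, fst (snd p), snd (snd (snd p)))"]) auto
  have e: "choi (cq_map \<Phi>) $ p $ q = cq_choi \<Phi> $ ?g p $ ?g q" for p q
    and \<Phi> :: "'x \<Rightarrow> 'y \<Rightarrow> ('m, 'n) map"
    by (cases p; cases q) (simp add: choi_nth cq_map_def cq_choi_def cq_op_entry)
  have "inner (choi (cq_map \<Phi>)) (choi (cq_map \<Psi>)) =
     (\<Sum>p\<in>UNIV. \<Sum>q\<in>UNIV. inner (cq_choi \<Phi> $ ?g p $ ?g q) (cq_choi \<Psi> $ ?g p $ ?g q))"
    by (simp only: inner_vec_def e)
  also have "\<dots> = (\<Sum>p\<in>UNIV. \<Sum>q\<in>UNIV. inner (cq_choi \<Phi> $ p $ q) (cq_choi \<Psi> $ p $ q))"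
    by (subst sum.reindex_bij_betw[OF g, symmetric], intro sum.cong refl, subst sum.reindex_bij_betw[OF g, symmetric]) simp
  also have "\<dots> = inner (cq_choi \<Phi>) (cq_choi \<Psi>)"
    by (simp only: inner_vec_def)
  also have "\<dots> = 1 / (real CARD('x))\<^sup>2 * inner (choi_family \<Phi>) (choi_family \<Psi>)"
    by (simp add: cq_choi_def inner_cq_op inner_op_family choi_family_def)
  finally show ?thesis .
qed

lemma Re_map_inner: "Re (map_inner \<Phi> \<Psi>) = inner (choi \<Phi>) (choi \<Psi>)"
  unfolding map_inner_def trace_def matrix_matrix_mult_def inner_op
  by (subst sum.swap) (simp add: adj_nth)

lemma cq_map_diff: "(\<lambda>\<rho>. cq_map \<Phi> \<rho> - cq_map \<Psi> \<rho>) = cq_map (\<lambda>x y \<rho>. \<Phi> x y \<rho> - \<Psi> x y \<rho>)"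
  by (auto simp: fun_eq_iff vec_eq_iff cq_map_def cq_op_nth algebra_simps)

lemma payoff_cq_map:
  fixes \<Phi> :: "'x::finite \<Rightarrow> 'y::finite \<Rightarrow> ('a0::finite, 'a1::finite) map"
    and \<Psi> \<Lambda> :: "'x \<Rightarrow> 'y \<Rightarrow> ('b0::finite, 'b1::finite) map"
  assumes \<Theta>: "superchannel \<Theta>" and \<Phi>: "\<And>x y. \<Phi> x y \<in> lin_maps"
  shows "payoff (cq_map \<Phi>) (cq_map \<Psi>) (cq_map \<Lambda>) \<Theta> = 1 / (real CARD('x))\<^sup>2 *
    inner (contract_family (choi_family \<Phi>) (super_choi \<Theta>) - choi_family \<Psi>) (choi_family \<Lambda>)"
proof -
  have lin: "linear_supermap \<Theta>" using \<Theta> by (simp add: superchannel_def)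
  have "choi_family (\<lambda>x y \<rho>. \<Theta> (\<Phi> x y) \<rho> - \<Psi> x y \<rho>) =
      contract_family (choi_family \<Phi>) (super_choi \<Theta>) - choi_family \<Psi>"
    by (simp add: vec_eq_iff choi_family_def contract_family_def choi_diff choi_linear_supermap[OF lin \<Phi>])
  then show ?thesis
    unfolding payoff_def id_XY_cq_map[of \<Theta> \<Phi>, OF lin \<Phi>] cq_map_diff Re_map_inner inner_choi_cq_map by simp
qed

section \<open>The constraints in terms of families of Choi matrices\<close>

lemma cq_map_inject:
  assumes "cq_map \<Phi> = cq_map \<Psi>"
  shows "\<Phi> = \<Psi>"
proof (intro ext)
  fix x y \<rho>
  have "cq_map \<Phi> \<rho> $ (x, y, i) $ (x, y, j) = cq_map \<Psi> \<rho> $ (x, y, i) $ (x, y, j)" for i j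
    using assms by simp
  then show "\<Phi> x y \<rho> = \<Psi> x y \<rho>" by (simp add: vec_eq_iff cq_map_def cq_op_nth)
qed

lemma C_star_iff: "N \<in> C_star \<longleftrightarrow> (\<exists>\<Lambda>. (\<forall>x y. \<Lambda> x y \<in> lin_maps) \<and> choi_family \<Lambda> \<in> conditional_chois \<and> N = cq_map \<Lambda>)"
  by (auto simp: C_star_def conditional_family_iff)

lemma choi_family_unchoi: "choi_family (\<lambda>x y. unchoi (L $ x $ y)) = L"
  by (simp add: choi_family_def vec_eq_iff)

lemma psd_mat_unit: "psd (mat_unit i i)"
  unfolding psd_iff_pos_kernel
  by (rule pos_kernel_gram[where U = "{()}" and w = "\<lambda>_ k. if k = i then 1 else 0"]) (auto simp: mat_unit_def)

lemma psd_cq_op: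
  fixes M :: "'x::finite \<Rightarrow> 'y::finite \<Rightarrow> 'n::finite op"
  shows "psd (cq_op M) \<longleftrightarrow> (\<forall>x y. psd (M x y))"
proof
  assume "\<forall>x y. psd (M x y)"
  then show "psd (cq_op M)"
    unfolding cq_op_def by (intro psd_scaleR psd_sum psd_tensor psd_mat_unit) auto
next
  assume *: "psd (cq_op M)"
  show "\<forall>x y. psd (M x y)"
  proof (intro allI)
    fix x y
    have "pos_kernel UNIV (\<lambda>i j. cq_op M $ (x, y, i) $ (x, y, j))"
      using pos_kernel_pullback[OF *[unfolded psd_iff_pos_kernel], of UNIV "\<lambda>i. (x, y, i)"] by simp
    then have "psd ((1 / real CARD('x)) *\<^sub>R M x y)"
      unfolding psd_iff_pos_kernel
      by (rule iffD1[OF pos_kernel_cong, rotated]) (simp add: cq_op_nth scaleR_conv_of_real[where 'a = complex])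
    from psd_scaleR[OF _ this, of "real CARD('x)"] show "psd (M x y)" by simp
  qed
qed

lemma ptrace_cq_choi:
  fixes \<Lambda> :: "'x::finite \<Rightarrow> 'y::finite \<Rightarrow> ('b0::finite, 'b1::finite) map"
  shows "ptrace (\<lambda>(x, b0) (y, b1). (x, y, b0, b1)) (cq_choi \<Lambda>) =
       (uniform :: 'x op) \<otimes> (mat 1 :: 'b0 op) \<longleftrightarrow>
    (\<forall>x. ptrace Pair (\<Sum>y\<in>UNIV. choi (\<Lambda> x y)) = mat 1)"
proof -
  have "(\<Sum>y\<in>UNIV. \<Sum>b1\<in>UNIV. cq_choi \<Lambda> $ (x, y, b, b1) $ (x', y, b', b1)) =
     (if x = x' then ptrace Pair (\<Sum>y\<in>UNIV. choi (\<Lambda> x y)) $ b $ b' / of_nat CARD('x) else 0)" for x x' b b'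
    by (simp add: cq_choi_def cq_op_nth sum_divide_distrib ptrace_def) (intro impI, rule sum.swap)
  then show ?thesis
    by (auto simp: vec_eq_iff ptrace_def[of "\<lambda>(x, b0) (y, b1). (x, y, b0, b1)"] sum_UNIV_prod tensor_def uniform_def mat_nth)
qed

lemma sdp_feasible_iff:
  fixes \<Phi> :: "'x::finite \<Rightarrow> 'y::finite \<Rightarrow> ('a0::finite, 'a1::finite) map"
    and \<Lambda> :: "'x \<Rightarrow> 'y \<Rightarrow> ('b0::finite, 'b1::finite) map"
  shows "sdp_feasible \<Phi> \<gamma> \<Lambda> \<longleftrightarrow> hermitian \<gamma> \<and> \<gamma> \<in> dual_ops \<and> (\<forall>x y. \<Lambda> x y \<in> lin_maps) \<and>
    choi_family \<Lambda> \<in> conditional_chois \<and>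
    psd (lift_B1 \<gamma> - (1 / real CARD('a0)) *\<^sub>R
      ((1 / (real CARD('x))\<^sup>2) *\<^sub>R pairing_op (choi_family \<Phi>) (choi_family \<Lambda>)))"
  unfolding sdp_feasible_def ptrace_cq_choi
  by (auto simp: loewner_le_def lift_B1_def dual_ops_def conditional_chois_def choi_family_def
      pairing_op_def cq_choi_def psd_cq_op)

lemma adj_cq_op: "adj (cq_op M) = cq_op (\<lambda>x y. adj (M x y))"
  by (auto simp: vec_eq_iff adj_nth cq_op_nth)

lemma Re_trace_cq_choi:
  fixes \<Psi> \<Lambda> :: "'x::finite \<Rightarrow> 'y::finite \<Rightarrow> ('m::finite, 'n::finite) map"
  assumes "choi_family \<Psi> \<in> conditional_chois"
  shows "Re (trace (cq_choi \<Psi> ** cq_choi \<Lambda>)) = 1 / (real CARD('x))\<^sup>2 * inner (choi_family \<Psi>) (choi_family \<Lambda>)"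
proof -
  have "adj (choi (\<Psi> x y)) = choi (\<Psi> x y)" for x y
    using assms psd_adj by (auto simp: conditional_chois_def choi_family_def)
  then have "adj (cq_choi \<Psi>) = cq_choi \<Psi>" by (simp add: cq_choi_def adj_cq_op)
  moreover have "Re (trace (X ** Y)) = inner (adj X) Y" for X Y :: "('x \<times> 'y \<times> 'm \<times> 'n) op"
    unfolding trace_def matrix_matrix_mult_def inner_op
    by (subst sum.swap) (simp add: adj_nth)
  ultimately show ?thesis
    by (simp add: cq_choi_def inner_cq_op inner_op_family choi_family_def)
qed

text \<open>If \<open>0\<close> is not among the attainable differences, then the uniform family, tilted against the
  point of smallest norm, yields a negative payoff for all superchannels.\<close>

lemma conditional_chois_separate:
  fixes S :: "('x::finite, 'y::finite, 'm::finite \<times> 'n::finite) op_family set"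
  assumes S: "compact S" "convex S" "S \<noteq> {}" "0 \<notin> S"
    and herm: "\<And>s x y. s \<in> S \<Longrightarrow> adj (s $ x $ y) = s $ x $ y"
    and marg: "\<And>s x. s \<in> S \<Longrightarrow> ptrace Pair (\<Sum>y\<in>UNIV. s $ x $ y) = 0"
  shows "\<exists>L\<in>conditional_chois. \<forall>s\<in>S. inner s L < 0"
proof -
  obtain s where s: "s \<in> S" and min: "\<And>t. t \<in> S \<Longrightarrow> dist 0 s \<le> dist 0 t"
    using distance_attains_inf[of S 0] S compact_imp_closed by blast
  have s0: "norm s > 0" using s S by auto
  \<comment> \<open>The variational inequality for the point of a convex set closest to the
    origin.\<close>
  have ge: "(norm s)\<^sup>2 \<le> inner s t" if "t \<in> S" for t
    using any_closest_point_dot[of S s t 0] min S s that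
    by (simp add: compact_imp_closed inner_diff_right power2_norm_eq_inner)
  \<comment> \<open>The constant for which the family of all \<open>c *\<^sub>R mat 1\<close> has
    the identity as marginal, after summing over y and tracing out the output.\<close>
  define c where "c = 1 / (real CARD('y) * real CARD('n))"
  have c: "c > 0" by (simp add: c_def)
  \<comment> \<open>With this tilt every perturbation \<open>e *\<^sub>R s $ x $ y\<close> has norm
    at most \<open>c\<close>, so positivity survives.\<close>
  define e where "e = c / norm s"
  have e: "e > 0" using c s0 by (simp add: e_def)
  define L :: "('x, 'y, 'm \<times> 'n) op_family" where "L = (\<chi> x y. c *\<^sub>R mat 1 - e *\<^sub>R s $ x $ y)"
  have one: "ptrace Pair (mat 1 :: ('m \<times> 'n) op) = real CARD('n) *\<^sub>R mat 1"
    by (auto simp: vec_eq_iff ptrace_def mat_nth scaleR_conv_of_real[where 'a = complex])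
  have "L \<in> conditional_chois"
    unfolding conditional_chois_def
  proof (intro CollectI conjI allI)
    fix x y
    have "norm (s $ x $ y) \<le> norm s" by (rule order_trans[OF Finite_Cartesian_Product.norm_nth_le Finite_Cartesian_Product.norm_nth_le])
    then have "norm (e *\<^sub>R s $ x $ y) \<le> c" using e s0 by (simp add: e_def field_simps)
    then show "psd (L $ x $ y)"
      unfolding L_def using herm[OF s] by (simp add: psd_scaled_identity_minus adj_scaleR)
  next
    fix x
    have "(\<Sum>y\<in>UNIV. L $ x $ y) = (real CARD('y) * c) *\<^sub>R mat 1 - e *\<^sub>R (\<Sum>y\<in>UNIV. s $ x $ y)"
      by (simp add: L_def sum_subtractf scaleR_sum_right sum_constant_scaleR del: sum_constant)
    then show "ptrace Pair (\<Sum>y\<in>UNIV. L $ x $ y) = mat 1"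
      by (simp only: ptrace_diff ptrace_scaleR marg[OF s] one) (simp add: c_def)
  qed
  moreover have "inner t L < 0" if t: "t \<in> S" for t
  proof -
    \<comment> \<open>The uniform part pairs to zero with \<open>t\<close>, whose marginals vanish;
      what remains is at most \<open>- e\<close> times the squared norm of \<open>s\<close>.\<close>
    have "inner t L = (\<Sum>x\<in>UNIV. \<Sum>y\<in>UNIV. c * inner (mat 1) (t $ x $ y)) - e * inner t s"
      by (simp add: inner_op_family L_def inner_diff_right sum_subtractf sum_distrib_left inner_commute)
    also have "(\<Sum>x\<in>UNIV. \<Sum>y\<in>UNIV. c * inner (mat 1) (t $ x $ y)) =
       c * (\<Sum>x\<in>UNIV. inner (mat 1) (\<Sum>y\<in>UNIV. t $ x $ y))"
      by (simp add: inner_sum_right sum_distrib_left)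
    also have "\<dots> = 0"
      unfolding inner_mat_1 trace_ptrace[symmetric] marg[OF t] by (simp add: trace_def)
    also have "0 - e * inner t s < 0"
      using mult_pos_pos[OF e less_le_trans[OF zero_less_power[OF s0] ge[OF t]]] by (simp add: inner_commute[of t])
    finally show ?thesis .
  qed
  ultimately show ?thesis by blast
qed

theorem mainTheorem3:
  fixes \<Phi> :: "'x::finite \<Rightarrow> 'y::finite \<Rightarrow> ('a0::finite, 'a1::finite) map"
    and \<Psi> :: "'x \<Rightarrow> 'y \<Rightarrow> ('b0::finite, 'b1::finite) map"
    and \<Phi>XYA :: "('a0, 'x \<times> 'y \<times> 'a1) map"
    and \<Psi>XYB :: "('b0, 'x \<times> 'y \<times> 'b1) map"
  assumes "conditional_family \<Phi>" and "\<Phi>XYA = cq_map \<Phi>"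
    and "conditional_family \<Psi>" and "\<Psi>XYB = cq_map \<Psi>"
  shows
    \<comment> \<open>the maximum and the minimum in the definition of \<open>minmax\<close> are attained\<close>
    "(\<forall>\<Lambda>\<in>C_star. \<exists>\<Theta>. superchannel \<Theta> \<and>
        (\<forall>\<Theta>'. superchannel \<Theta>' \<longrightarrow> payoff \<Phi>XYA \<Psi>XYB \<Lambda> \<Theta>' \<le> payoff \<Phi>XYA \<Psi>XYB \<Lambda> \<Theta>)) \<and>
     (\<exists>\<Lambda>\<in>C_star. \<forall>\<Lambda>'\<in>C_star. max_payoff \<Phi>XYA \<Psi>XYB \<Lambda> \<le> max_payoff \<Phi>XYA \<Psi>XYB \<Lambda>') \<and>
     ((\<exists>\<Theta>. superchannel \<Theta> \<and> \<Psi>XYB = id_XY \<Theta> \<Phi>XYA) \<longleftrightarrow> minmax \<Phi>XYA \<Psi>XYB \<ge> 0) \<and>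
     (minmax \<Phi>XYA \<Psi>XYB \<in> sdp_values \<Phi> \<Psi> \<and> (\<forall>v\<in>sdp_values \<Phi> \<Psi>. minmax \<Phi>XYA \<Psi>XYB \<le> v))"
proof -
  define F where "F = choi_family \<Phi>"
  define P where "P = choi_family \<Psi>"
  define k where "k = 1 / (real CARD('x))\<^sup>2"
  have k: "k > 0" by (simp add: k_def)
  have lin\<Phi>: "\<Phi> x y \<in> lin_maps" and lin\<Psi>: "\<Psi> x y \<in> lin_maps" for x y
    using assms by (auto simp: conditional_family_iff)
  have F: "F \<in> conditional_chois" and P: "P \<in> conditional_chois"
    using assms by (auto simp: conditional_family_iff F_def P_def)
  let ?T = "conditional_chois :: ('x, 'y, 'b0 \<times> 'b1) op_family set"
  let ?C = "superchannel_chois :: (('a0 \<times> 'a1) \<times> ('b0 \<times> 'b1)) op set"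
  let ?s = "\<lambda>J. contract_family F J - P"
  let ?S = "?s ` ?C"
  let ?Fam = "\<lambda>\<Lambda> :: 'x \<Rightarrow> 'y \<Rightarrow> ('b0, 'b1) map. (\<forall>x y. \<Lambda> x y \<in> lin_maps) \<and> choi_family \<Lambda> \<in> ?T"
  note payoff_family = payoff_cq_map[of _ \<Phi> \<Psi>, OF _ lin\<Phi>, folded F_def P_def k_def]
  have pay: "payoff \<Phi>XYA \<Psi>XYB (cq_map \<Lambda>) \<Theta> = k * inner (?s (super_choi \<Theta>)) (choi_family \<Lambda>)"
    if "superchannel \<Theta>" for \<Lambda> and \<Theta> :: "('a0, 'a1) map \<Rightarrow> ('b0, 'b1) map"
    using that by (simp add: assms payoff_family)
  have pay_un: "payoff \<Phi>XYA \<Psi>XYB (cq_map \<Lambda>) (super_unchoi J) = k * inner (?s J) (choi_family \<Lambda>)"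
    if "J \<in> ?C" for \<Lambda> J
  proof -
    \<comment> \<open>\<open>super_choi (super_unchoi J)\<close> is compared with \<open>J\<close>
      through its action on the given family, which is all that the payoff sees.\<close>
    have "contract (super_choi (super_unchoi J)) (choi (\<Phi> x y)) = contract J (choi (\<Phi> x y))" for x y
      using superchannel_super_unchoi[OF that] lin\<Phi>[of x y]
      by (metis choi_linear_supermap choi_super_unchoi superchannel_def)
    then have "?s (super_choi (super_unchoi J)) = ?s J"
      by (simp add: contract_family_def F_def choi_family_def vec_eq_iff)
    then show ?thesis using pay[OF superchannel_super_unchoi[OF that]] by simp
  qed

  have S_image: "?S = (\<lambda>x. x - P) ` (contract_family F ` ?C)" by auto
  have bl: "bounded_linear (contract_family F :: (('a0 \<times> 'a1) \<times> ('b0 \<times> 'b1)) op \<Rightarrow> _)"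
    using linear_contract_family linear_conv_bounded_linear by blast
  have S: "compact ?S" "convex ?S" "?S \<noteq> {}"
    unfolding S_image
    using compact_superchannel_chois convex_superchannel_chois superchannel_chois_nonempty
    by (auto intro!: compact_translation_subtract compact_continuous_image linear_continuous_on bl
        convex_translation_subtract convex_linear_image linear_contract_family)
  \<comment> \<open>The support function of the set of attainable differences.\<close>
  define h where "h L = (SUP s\<in>?S. inner s L)" for L
  have attained: "\<exists>s\<in>?S. \<forall>t\<in>?S. inner t L \<le> inner s L" for L
    by (rule continuous_attains_sup[OF S(1,3)]) (intro continuous_intros)
  have h: "\<exists>J\<in>?C. h L = inner (?s J) L \<and> (\<forall>J'\<in>?C. inner (?s J') L \<le> h L)" for L
  proof -
    obtain J where J: "J \<in> ?C" "\<And>J'. J' \<in> ?C \<Longrightarrow> inner (?s J') L \<le> inner (?s J) L"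
      using attained[of L] by blast
    then have "h L = inner (?s J) L"
      unfolding h_def by (intro cSup_eq_maximum) auto
    then show ?thesis using J by auto
  qed

  have max: "max_payoff \<Phi>XYA \<Psi>XYB (cq_map \<Lambda>) = k * h (choi_family \<Lambda>)" for \<Lambda>
    unfolding max_payoff_def
  proof (rule Greatest_equality)
    show "\<exists>\<Theta>. superchannel \<Theta> \<and> k * h (choi_family \<Lambda>) = payoff \<Phi>XYA \<Psi>XYB (cq_map \<Lambda>) \<Theta>"
      using h[of "choi_family \<Lambda>"] pay_un superchannel_super_unchoi by metis
    show "r \<le> k * h (choi_family \<Lambda>)" if r: "\<exists>\<Theta>. superchannel \<Theta> \<and> r = payoff \<Phi>XYA \<Psi>XYB (cq_map \<Lambda>) \<Theta>" for r
    proof -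
      obtain \<Theta> where \<Theta>: "superchannel \<Theta>" "r = payoff \<Phi>XYA \<Psi>XYB (cq_map \<Lambda>) \<Theta>" using r by blast
      then show ?thesis
        using h[of "choi_family \<Lambda>"] super_choi_superchannel[OF \<Theta>(1)] k by (auto simp: pay)
    qed
  qed

  \<comment> \<open>\<open>P\<close> itself witnesses that the set of conditional families is
    nonempty.\<close>
  obtain L0 where L0: "L0 \<in> ?T" "\<And>L. L \<in> ?T \<Longrightarrow> h L0 \<le> h L"
    using support_function_attains_inf[OF S(1) compact_conditional_chois, of h] h P by (metis (no_types, lifting) empty_iff image_iff)
  define \<Lambda>0 where "\<Lambda>0 = (\<lambda>x y. unchoi (L0 $ x $ y))"
  have \<Lambda>0: "?Fam \<Lambda>0" "choi_family \<Lambda>0 = L0"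
    using L0 by (auto simp: \<Lambda>0_def choi_family_unchoi)
  have C0: "cq_map \<Lambda>0 \<in> C_star" using \<Lambda>0 C_star_iff by blast
  have minmax: "minmax \<Phi>XYA \<Psi>XYB = k * h L0"
    unfolding minmax_def
  proof (rule Least_equality)
    show "\<exists>\<Lambda>\<in>C_star. k * h L0 = max_payoff \<Phi>XYA \<Psi>XYB \<Lambda>"
      using C0 max[of \<Lambda>0] \<Lambda>0 by metis
    show "k * h L0 \<le> r" if "\<exists>\<Lambda>\<in>C_star. r = max_payoff \<Phi>XYA \<Psi>XYB \<Lambda>" for r
      using that L0 k by (auto simp: C_star_iff max)
  qed

  have exact: "(\<exists>\<Theta>. superchannel \<Theta> \<and> \<Psi>XYB = id_XY \<Theta> \<Phi>XYA) \<longleftrightarrow> 0 \<in> ?S"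
  proof
    assume "\<exists>\<Theta>. superchannel \<Theta> \<and> \<Psi>XYB = id_XY \<Theta> \<Phi>XYA"
    then obtain \<Theta> :: "('a0, 'a1) map \<Rightarrow> ('b0, 'b1) map"
      where \<Theta>: "superchannel \<Theta>" "cq_map \<Psi> = id_XY \<Theta> (cq_map \<Phi>)" by (auto simp: assms)
    then have lin: "linear_supermap \<Theta>" by (simp add: superchannel_def)
    have "\<Psi> = (\<lambda>x y. \<Theta> (\<Phi> x y))"
      using \<Theta>(2) unfolding id_XY_cq_map[of \<Theta> \<Phi>, OF lin lin\<Phi>] by (rule cq_map_inject)
    then have "?s (super_choi \<Theta>) = 0"
      by (simp add: contract_family_def F_def P_def choi_family_def vec_eq_iff choi_linear_supermap[OF lin lin\<Phi>])
    then show "0 \<in> ?S" using super_choi_superchannel[OF \<Theta>(1)] by (metis imageI)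
  next
    assume "0 \<in> ?S"
    then obtain J where J: "J \<in> ?C" "?s J = 0" by auto
    have lin: "linear_supermap (super_unchoi J)"
      using superchannel_super_unchoi[OF J(1)] by (simp add: superchannel_def)
    have "contract J (choi (\<Phi> x y)) = choi (\<Psi> x y)" for x y
      using arg_cong[OF J(2), of "\<lambda>L. L $ x $ y"] by (simp add: contract_family_def F_def P_def choi_family_def)
    then have "super_unchoi J (\<Phi> x y) = \<Psi> x y" for x y
      using lin\<Psi> by (simp add: super_unchoi_def unchoi_choi)
    then have "id_XY (super_unchoi J) (cq_map \<Phi>) = cq_map \<Psi>"
      unfolding id_XY_cq_map[of "super_unchoi J" \<Phi>, OF lin lin\<Phi>] by simp
    then show "\<exists>\<Theta>. superchannel \<Theta> \<and> \<Psi>XYB = id_XY \<Theta> \<Phi>XYA"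
      using superchannel_super_unchoi[OF J(1)] assms by metis
  qed
  have diff: "adj (s $ x $ y) = s $ x $ y" "ptrace Pair (\<Sum>y\<in>UNIV. s $ x $ y) = 0" if "s \<in> ?S" for s x y
  proof -
    obtain J where J: "J \<in> ?C" "s = ?s J" using \<open>s \<in> ?S\<close> by blast
    have G: "contract_family F J \<in> ?T" using J F by (intro contract_family_conditional)
    show "adj (s $ x $ y) = s $ x $ y"
      using G P by (simp add: J adj_diff conditional_chois_def psd_adj)
    show "ptrace Pair (\<Sum>y\<in>UNIV. s $ x $ y) = 0"
      using G P by (auto simp: J ptrace_diff sum_subtractf conditional_chois_def)
  qed
  have zero: "0 \<in> ?S \<longleftrightarrow> h L0 \<ge> 0"
  proof
    assume "0 \<in> ?S"
    then obtain J where J: "J \<in> ?C" "?s J = 0" by auto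
    have "inner (?s J) L0 \<le> h L0" using h[of L0] J(1) by blast
    then show "h L0 \<ge> 0" by (simp add: J(2))
  next
    assume pos: "h L0 \<ge> 0"
    show "0 \<in> ?S"
    proof (rule ccontr)
      assume "0 \<notin> ?S"
      then obtain L where L: "L \<in> ?T" "\<And>s. s \<in> ?S \<Longrightarrow> inner s L < 0"
        using conditional_chois_separate[OF S _ diff] by blast
      then have "h L < 0" using h[of L] by auto
      then show False using L0(2)[OF L(1)] pos by simp
    qed
  qed

  have pairing: "inner J (k *\<^sub>R pairing_op F L) = k * inner (contract_family F J) L" for J and L :: "('x, 'y, 'b0 \<times> 'b1) op_family"
    by (simp add: inner_pairing_op[OF F])
  have herm: "adj (k *\<^sub>R pairing_op F L0) = k *\<^sub>R pairing_op F L0"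
    using F L0(1) k unfolding pairing_op_def
    by (intro psd_adj psd_scaleR psd_sum psd_tensor psd_transpose) (auto simp: conditional_chois_def)
  note feas = sdp_feasible_iff[of \<Phi>, folded F_def k_def]
  have val: "Re (trace \<gamma> - trace (cq_choi \<Psi> ** cq_choi \<Lambda>)) = Re (trace \<gamma>) - k * inner P (choi_family \<Lambda>)" for \<gamma> \<Lambda>
    using Re_trace_cq_choi[of \<Psi> \<Lambda>] P by (simp add: P_def k_def)
  have "minmax \<Phi>XYA \<Psi>XYB \<le> v" if "v \<in> sdp_values \<Phi> \<Psi>" for v
  proof -
    obtain \<gamma> \<Lambda> where v: "v = Re (trace \<gamma> - trace (cq_choi \<Psi> ** cq_choi \<Lambda>))" and f: "sdp_feasible \<Phi> \<gamma> \<Lambda>"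
      using \<open>v \<in> sdp_values \<Phi> \<Psi>\<close> unfolding sdp_values_def by blast
    let ?L = "choi_family \<Lambda>"
    \<comment> \<open>With the \<open>J\<close> that is best against this feasible \<Lambda>, weak
      duality bounds the whole maximum \<open>h ?L\<close> and not just one payoff.\<close>
    obtain J where J: "J \<in> ?C" "h ?L = inner (?s J) ?L" using h[of ?L] by blast
    have "inner J (k *\<^sub>R pairing_op F ?L) \<le> Re (trace \<gamma>)"
      using f J(1) by (intro superchannel_weak_duality) (auto simp: feas)
    then have "k * h ?L \<le> v"
      unfolding v val J(2) pairing by (simp add: inner_diff_left right_diff_distrib)
    moreover have "k * h L0 \<le> k * h ?L"
      using L0(2)[of ?L] f k by (simp add: feas)
    ultimately show ?thesis by (simp add: minmax)
  qed
  moreover have "minmax \<Phi>XYA \<Psi>XYB \<in> sdp_values \<Phi> \<Psi>"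
  proof -
    \<comment> \<open>At the minimising family strong duality gives a feasible \<gamma> whose value
      is the payoff of an actual superchannel, hence at most \<open>minmax\<close>; the lower bound
      just proved makes the two equal.\<close>
    obtain J \<gamma> where J: "J \<in> ?C" and \<gamma>: "\<gamma> \<in> dual_ops" "hermitian \<gamma>"
      "psd (lift_B1 \<gamma> - (1 / real CARD('a0)) *\<^sub>R (k *\<^sub>R pairing_op F L0))"
      and tr: "Re (trace \<gamma>) = inner J (k *\<^sub>R pairing_op F L0)"
      using superchannel_strong_duality[OF herm] by blast
    have f: "sdp_feasible \<Phi> \<gamma> \<Lambda>0" using \<gamma> \<Lambda>0 by (simp add: feas)
    have v: "Re (trace \<gamma> - trace (cq_choi \<Psi> ** cq_choi \<Lambda>0)) = k * inner (?s J) L0"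
      unfolding val tr pairing \<Lambda>0(2) by (simp add: inner_diff_left right_diff_distrib)
    also have "\<dots> \<le> minmax \<Phi>XYA \<Psi>XYB"
      using h[of L0] J k by (auto simp: minmax)
    finally have le: "Re (trace \<gamma> - trace (cq_choi \<Psi> ** cq_choi \<Lambda>0)) \<le> minmax \<Phi>XYA \<Psi>XYB" .
    have in_values: "Re (trace \<gamma> - trace (cq_choi \<Psi> ** cq_choi \<Lambda>0)) \<in> sdp_values \<Phi> \<Psi>"
      using f unfolding sdp_values_def by blast
    from \<open>\<And>v. v \<in> sdp_values \<Phi> \<Psi> \<Longrightarrow> minmax \<Phi>XYA \<Psi>XYB \<le> v\<close>[OF in_values] le in_values
    show ?thesis by simp
  qed
  moreover have "\<exists>\<Theta>. superchannel \<Theta> \<and> (\<forall>\<Theta>'. superchannel \<Theta>' \<longrightarrow> payoff \<Phi>XYA \<Psi>XYB N \<Theta>' \<le> payoff \<Phi>XYA \<Psi>XYB N \<Theta>)"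
    if N: "N \<in> C_star" for N
  proof -
    obtain \<Lambda> where \<Lambda>: "N = cq_map \<Lambda>" using N C_star_iff by blast
    obtain J where J: "J \<in> ?C" "h (choi_family \<Lambda>) = inner (?s J) (choi_family \<Lambda>)"
      "\<And>J'. J' \<in> ?C \<Longrightarrow> inner (?s J') (choi_family \<Lambda>) \<le> h (choi_family \<Lambda>)"
      using h[of "choi_family \<Lambda>"] by blast
    show ?thesis
    proof (intro exI conjI allI impI)
      show "superchannel (super_unchoi J)" by (rule superchannel_super_unchoi[OF J(1)])
      fix \<Theta>' :: "('a0, 'a1) map \<Rightarrow> ('b0, 'b1) map"
      assume "superchannel \<Theta>'"
      then show "payoff \<Phi>XYA \<Psi>XYB N \<Theta>' \<le> payoff \<Phi>XYA \<Psi>XYB N (super_unchoi J)"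
        using J(3)[OF super_choi_superchannel] k unfolding \<Lambda> by (simp add: pay pay_un[OF J(1)] J(2))
    qed
  qed
  moreover have "max_payoff \<Phi>XYA \<Psi>XYB (cq_map \<Lambda>0) \<le> max_payoff \<Phi>XYA \<Psi>XYB N" if "N \<in> C_star" for N
    using that L0(2) k by (auto simp: C_star_iff max \<Lambda>0(2))
  moreover have "(\<exists>\<Theta>. superchannel \<Theta> \<and> \<Psi>XYB = id_XY \<Theta> \<Phi>XYA) \<longleftrightarrow> minmax \<Phi>XYA \<Psi>XYB \<ge> 0"
    using k by (simp add: exact zero minmax zero_le_mult_iff)
  ultimately show ?thesis using C0 by blast
qed

end
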